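(* Let $G$ be a Lie groupoid with Lie algebroid $\mathcal{G}$, let $x_0\in G^{(0)}$, let $\psi:U\times V\to G$, $\varphi:U\to G^{(0)}$ be adapted charts at $x_0$, and let $\sigma$, $B$, the local frame $\{e_1,\dots,e_m\}$ of $\mathcal{G}$ over $\varphi(U)$ and the coordinates $q_1,\dots,q_n$ be as in the context. Let $a_{ij}$ ($1\le i\le m$, $1\le j\le n$) and $c_{ijk}$ ($1\le i,j,k\le m$) be the structure functions of $\mathcal{G}$ on $\varphi(U)$, defined by $a_{ij}=\overline{\rho}(e_i)(q_j)$ and $[e_i,e_j]=\sum_k c_{ijk}e_k$. Then for every $u\in U$, $$a_{ij}(\varphi(u))=\frac{\partial\sigma_j}{\partial v_i}(u,0),\qquad c_{ijk}(\varphi(u))=B_k(u,f_i,f_j)-B_k(u,f_j,f_i),$$ where $\sigma_j$ is the $j$-th component of $\sigma$, $\{f_1,\dots,f_m\}$ is the canonical basis of $\mathbb{R}^m$, and $B_1,\dots,B_m$ are the components of $B$ in this basis.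
   Context: A groupoid $G$ has a partially defined product on $G^{(2)}\subset G\times G$ and an inversion; $r(g)=gg^{-1}$, $s(g)=g^{-1}g$, the unit space is $G^{(0)}=r(G)=s(G)\subset G$, and $g_1g_2$ is defined if and only if $s(g_1)=r(g_2)$. A Lie groupoid is a groupoid $G$ with a smooth manifold structure such that $G^{(0)}$ is a submanifold, $r,s:G\to G^{(0)}$ are submersions, and multiplication is smooth. Write $G^x=r^{-1}(x)$ and, for $g\in G$, $L_g:G^{s(g)}\to G^{r(g)}$, $L_g(h)=gh$. Lie algebroid of $G$: $\mathcal{G}$ is the vector bundle over $G^{(0)}$ with fibre $\mathcal{G}_x=\ker T_xr=T_xG^x$ at $x\in G^{(0)}$. A left-invariant vector field on $G$ is a smooth vector field $\xi$ with values in $\ker Tr$ such that $TL_g\circ\xi=\xi\circ L_g$ for all $g\in G$. Restriction to $G^{(0)}$ is a linear isomorphism $\Phi$ from left-invariant vector fields onto $C^\infty(G^{(0)},\mathcal{G})$, with inverse $\Phi^{-1}(\xi)(g)=(T_{s(g)}L_g)\,\xi(s(g))$. The bracket on $C^\infty(G^{(0)},\mathcal{G})$ is $[\xi,\eta]=\Phi([\Phi^{-1}(\xi),\Phi^{-1}(\eta)])$, and the anchor is $\rho:\mathcal{G}\to TG^{(0)}$, $\rho_x=T_xs$ restricted to $\mathcal{G}_x$; $\overline{\rho}$ is the induced map on sections, $\overline{\rho}(\xi)(x)=\rho(\xi(x))$. Let $n=\dim G^{(0)}$ and $m=\dim G-\dim G^{(0)}$. Adapted charts at $x_0\in G^{(0)}$: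 $U$ is an open neighbourhood of $0$ in $\mathbb{R}^n$, $V$ an open neighbourhood of $0$ in $\mathbb{R}^m$, and $\psi:U\times V\to G$, $\varphi:U\to G^{(0)}$ are charts (diffeomorphisms onto open subsets) such that (1) $\psi(0,0)=x_0$; (2) $r(\psi(u,v))=\varphi(u)$; (3) $\psi(U\times\{0\})=\psi(U\times V)\cap G^{(0)}$. Consequently $\varphi(u)=\psi(u,0)$. Frame and coordinates: $e_i(\varphi(u))=\frac{\partial\psi}{\partial v}(u,0)f_i\in\mathcal{G}_{\varphi(u)}$ for $1\le i\le m$; $q_j=\mathrm{pr}_j\circ\varphi^{-1}$ for $1\le j\le n$. The map $\sigma$: $\sigma=\varphi^{-1}\circ s\circ\psi$, defined on the open set $D=\{(u,v)\in U\times V: s(\psi(u,v))\in\varphi(U)\}\supset U\times\{0\}$, with values in $U$. The map $B$: on the open set of those $(u,v,w)\in U\times V\times V$ with $(u,v)\in D$ and $\psi(u,v)\psi(\sigma(u,v),w)\in\psi(U\times V)$, the product is given by $\psi(u,v)\psi(\sigma(u,v),w)=\psi(u,p(u,v,w))$ with $p$ smooth and $V$-valued. It has an expansion $p(u,v,w)=v+w+B(u,v,w)+O_3(u,v,w)$ with $B(u,\cdot,\cdot):\mathbb{R}^m\times\mathbb{R}^m\to\mathbb{R}^m$ bilinear for each $u$ and $O_3(u,v,w)=O(\|(v,w)\|^3)$ as $(v,w)\to(0,0)$; this determines $B$. *)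

theory Defs
  imports "HOL-Analysis.Analysis" "HOL-Library.Landau_Symbols"
begin

section \<open>The model spaces\<close>

text \<open>
  The space \<open>\<real>\<^sup>n\<close> is represented by a real inner product space together with an orthonormal basis
  \<open>b 1, \<dots>, b n\<close>, playing the role of the canonical basis; the \<open>i\<close>-th coordinate of \<open>x\<close> is
  \<open>x \<bullet> b i\<close>. In contrast to \<^typ>\<open>real ^ 'n\<close> and \<^class>\<open>euclidean_space\<close> this includes \<open>n = 0\<close>
  (so that a Lie group, whose unit space is a point, is a Lie groupoid).
\<close>

definition canonical_basis :: "nat \<Rightarrow> (nat \<Rightarrow> 'v::real_inner) \<Rightarrow> bool" where
  "canonical_basis n b \<longleftrightarrow>
     (\<forall>i\<in>{1..n}. \<forall>j\<in>{1..n}. b i \<bullet> b j = (if i = j then 1 else 0)) \<and> span (b ` {1..n}) = UNIV"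

text \<open>
  \<open>C\<^sup>k\<close> and smooth maps on open subsets of (finite-dimensional) normed spaces: all iterated
  directional derivatives exist (as values of Frechet derivatives) and are continuous.
\<close>

primrec Ck_on :: "nat \<Rightarrow> 'v::real_normed_vector set \<Rightarrow> ('v \<Rightarrow> 'w::real_normed_vector) \<Rightarrow> bool" where
  "Ck_on 0 S f \<longleftrightarrow> continuous_on S f"
| "Ck_on (Suc k) S f \<longleftrightarrow>
     (\<forall>x\<in>S. f differentiable (at x)) \<and> (\<forall>v. Ck_on k S (\<lambda>x. frechet_derivative f (at x) v))"

definition smooth_on :: "'v::real_normed_vector set \<Rightarrow> ('v \<Rightarrow> 'w::real_normed_vector) \<Rightarrow> bool" where
  "smooth_on S f \<longleftrightarrow> (\<forall>k. Ck_on k S f)"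


section \<open>Smooth manifolds\<close>

text \<open>
  A chart is given by its domain and its coordinate map (only relevant on the domain). The
  underlying set of a manifold is the union of the domains of its atlas, with the subspace topology
  of the ambient type.
\<close>

type_synonym ('p, 'e) atlas = "('p set \<times> ('p \<Rightarrow> 'e)) set"

definition carrier_of :: "('p, 'e) atlas \<Rightarrow> 'p set" where
  "carrier_of A = \<Union> (fst ` A)"

definition open_in :: "('p::topological_space, 'e) atlas \<Rightarrow> 'p set \<Rightarrow> bool" where
  "open_in A W \<longleftrightarrow> openin (top_of_set (carrier_of A)) W"

definition is_chart ::
  "'p::topological_space set \<Rightarrow> 'p set \<times> ('p \<Rightarrow> 'e::real_normed_vector) \<Rightarrow> bool" where
  "is_chart M = (\<lambda>(D, c). openin (top_of_set M) D \<and> open (c ` D) \<and>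
     homeomorphism D (c ` D) c (inv_into D c))"

definition compatible ::
  "'p set \<times> ('p \<Rightarrow> 'e::real_normed_vector) \<Rightarrow> 'p set \<times> ('p \<Rightarrow> 'e) \<Rightarrow> bool" where
  "compatible = (\<lambda>(D, c) (D', c').
     smooth_on (c ` (D \<inter> D')) (c' \<circ> inv_into D c) \<and>
     smooth_on (c' ` (D \<inter> D')) (c \<circ> inv_into D' c'))"

definition smooth_atlas :: "('p::topological_space, 'e::real_normed_vector) atlas \<Rightarrow> bool" where
  "smooth_atlas A \<longleftrightarrow>
     (\<forall>C\<in>A. is_chart (carrier_of A) C) \<and> (\<forall>C\<in>A. \<forall>C'\<in>A. compatible C C')"

definition maximal_atlas ::
  "('p::topological_space, 'e::real_normed_vector) atlas \<Rightarrow> ('p, 'e) atlas" where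
  "maximal_atlas A = {C. is_chart (carrier_of A) C \<and> (\<forall>C'\<in>A. compatible C C')}"

definition euclid :: "('v::real_normed_vector, 'v) atlas" where
  "euclid = {(UNIV, id)}"

definition prod_atlas :: "('p, 'e) atlas \<Rightarrow> ('q, 'f) atlas \<Rightarrow> ('p \<times> 'q, 'e \<times> 'f) atlas" where
  "prod_atlas A B = {(D \<times> D', map_prod c c') | D c D' c'. (D, c) \<in> A \<and> (D', c') \<in> B}"

definition smooth_map ::
  "('p::topological_space, 'e::real_normed_vector) atlas \<Rightarrow>
   ('q::topological_space, 'f::real_normed_vector) atlas \<Rightarrow> 'p set \<Rightarrow> ('p \<Rightarrow> 'q) \<Rightarrow> bool" where
  "smooth_map A B W F \<longleftrightarrow> open_in A W \<and>
     (\<forall>x\<in>W. \<exists>(D, c)\<in>A. \<exists>(D', c')\<in>B. x \<in> D \<and> F x \<in> D' \<and>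
        (\<exists>Q. open_in A Q \<and> x \<in> Q \<and> Q \<subseteq> W \<inter> D \<and> F ` Q \<subseteq> D' \<and>
             smooth_on (c ` Q) (c' \<circ> F \<circ> inv_into D c)))"

text \<open>
  Smoothness of a map defined on a (not necessarily open) subset: local extendability to a smooth
  map on an open set. For an embedded submanifold \<open>S\<close> this is smoothness with respect to the
  submanifold structure of \<open>S\<close>.
\<close>

definition smooth_map_on_subset ::
  "('p::topological_space, 'e::real_normed_vector) atlas \<Rightarrow>
   ('q::topological_space, 'f::real_normed_vector) atlas \<Rightarrow> 'p set \<Rightarrow> ('p \<Rightarrow> 'q) \<Rightarrow> bool" where
  "smooth_map_on_subset A B S F \<longleftrightarrow>
     (\<forall>x\<in>S. \<exists>W F'. x \<in> W \<and> smooth_map A B W F' \<and> (\<forall>y\<in>W \<inter> S. F' y = F y))"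

definition diffeo_onto_open ::
  "('p::topological_space, 'e::real_normed_vector) atlas \<Rightarrow>
   ('q::topological_space, 'f::real_normed_vector) atlas \<Rightarrow> 'p set \<Rightarrow> ('p \<Rightarrow> 'q) \<Rightarrow> bool" where
  "diffeo_onto_open A B W F \<longleftrightarrow>
     smooth_map A B W F \<and> inj_on F W \<and> smooth_map B A (F ` W) (inv_into W F)"

text \<open>
  Embedded submanifolds, described by slice charts with values in \<open>'a \<times> 'b\<close>; the submanifold is
  modelled on the first factor.
\<close>

definition submanifold_atlas ::
  "('p::topological_space, 'a::real_normed_vector \<times> 'b::real_normed_vector) atlas \<Rightarrow> 'p set \<Rightarrow>
   ('p, 'a) atlas" where
  "submanifold_atlas A N = {(D \<inter> N, fst \<circ> c) | D c.
     (D, c) \<in> maximal_atlas A \<and> c ` (D \<inter> N) = {z \<in> c ` D. snd z = 0}}"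

definition embedded_submanifold ::
  "('p::topological_space, 'a::real_normed_vector \<times> 'b::real_normed_vector) atlas \<Rightarrow> 'p set \<Rightarrow> bool" where
  "embedded_submanifold A N \<longleftrightarrow> carrier_of (submanifold_atlas A N) = N"


section \<open>Tangent vectors and vector fields\<close>

text \<open>
  Germs at \<open>x\<close> are represented by functions on the ambient type that are smooth near \<open>x\<close>. Tangent
  vectors at \<open>x\<close> are derivations on germs; they are extended by \<open>0\<close> to functions which are not
  smooth near \<open>x\<close>, so that equality of tangent vectors is equality in HOL.
\<close>

definition smooth_germs ::
  "('p::topological_space, 'e::real_normed_vector) atlas \<Rightarrow> 'p \<Rightarrow> ('p \<Rightarrow> real) set" where
  "smooth_germs A x = {h. \<exists>W. x \<in> W \<and> smooth_map A euclid W h}"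

type_synonym 'p tangent = "('p \<Rightarrow> real) \<Rightarrow> real"

definition tangent_space ::
  "('p::topological_space, 'e::real_normed_vector) atlas \<Rightarrow> 'p \<Rightarrow> 'p tangent set" where
  "tangent_space A x = {v.
     (\<forall>h\<in>smooth_germs A x. \<forall>k\<in>smooth_germs A x.
        (\<forall>a b. v (\<lambda>y. a * h y + b * k y) = a * v h + b * v k) \<and>
        v (\<lambda>y. h y * k y) = h x * v k + k x * v h \<and>
        ((\<exists>W. open_in A W \<and> x \<in> W \<and> (\<forall>y\<in>W. h y = k y)) \<longrightarrow> v h = v k)) \<and>
     (\<forall>h. h \<notin> smooth_germs A x \<longrightarrow> v h = 0)}"

definition tangent_map ::
  "('q::topological_space, 'f::real_normed_vector) atlas \<Rightarrow> ('p \<Rightarrow> 'q) \<Rightarrow> 'p \<Rightarrow>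
   'p tangent \<Rightarrow> 'q tangent" where
  "tangent_map B F x v = (\<lambda>h. if h \<in> smooth_germs B (F x) then v (h \<circ> F) else 0)"

definition submersion ::
  "('p::topological_space, 'e::real_normed_vector) atlas \<Rightarrow>
   ('q::topological_space, 'f::real_normed_vector) atlas \<Rightarrow> ('p \<Rightarrow> 'q) \<Rightarrow> bool" where
  "submersion A B F \<longleftrightarrow> smooth_map A B (carrier_of A) F \<and>
     (\<forall>x\<in>carrier_of A. tangent_map B F x ` tangent_space A x = tangent_space B (F x))"

text \<open>The velocity at time \<open>0\<close> of a curve that is smooth near \<open>0\<close>.\<close>

definition velocity ::
  "('p::topological_space, 'e::real_normed_vector) atlas \<Rightarrow> (real \<Rightarrow> 'p) \<Rightarrow> 'p tangent" where
  "velocity A \<gamma> = (\<lambda>h. if h \<in> smooth_germs A (\<gamma> 0) then deriv (h \<circ> \<gamma>) 0 else 0)"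

definition lie_bracket ::
  "('p::topological_space, 'e::real_normed_vector) atlas \<Rightarrow>
   ('p \<Rightarrow> 'p tangent) \<Rightarrow> ('p \<Rightarrow> 'p tangent) \<Rightarrow> 'p \<Rightarrow> 'p tangent" where
  "lie_bracket A X Y x =
     (\<lambda>h. if h \<in> smooth_germs A x then X x (\<lambda>y. Y y h) - Y x (\<lambda>y. X y h) else 0)"


section \<open>Lie groupoids\<close>

text \<open>
  The groupoid and its total space are a whole type. The product \<open>gmul\<close> is a total function in HOL,
  but it is only meaningful on \<open>composable\<close>; the axioms do not constrain it elsewhere.
\<close>

record ('g, 'e) groupoid_manifold =
  gmul :: "'g \<Rightarrow> 'g \<Rightarrow> 'g"
  ginv :: "'g \<Rightarrow> 'g"
  gatlas :: "('g, 'e) atlas"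

definition rng :: "('g, 'e) groupoid_manifold \<Rightarrow> 'g \<Rightarrow> 'g" where
  "rng G g = gmul G g (ginv G g)"

definition src :: "('g, 'e) groupoid_manifold \<Rightarrow> 'g \<Rightarrow> 'g" where
  "src G g = gmul G (ginv G g) g"

definition units :: "('g, 'e) groupoid_manifold \<Rightarrow> 'g set" where
  "units G = range (rng G)"

definition composable :: "('g, 'e) groupoid_manifold \<Rightarrow> ('g \<times> 'g) set" where
  "composable G = {(g, h). src G g = rng G h}"

definition groupoid :: "('g, 'e) groupoid_manifold \<Rightarrow> bool" where
  "groupoid G \<longleftrightarrow>
     (\<forall>g h k. (g, h) \<in> composable G \<and> (h, k) \<in> composable G \<longrightarrow>
        (gmul G g h, k) \<in> composable G \<and> (g, gmul G h k) \<in> composable G \<and>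
        gmul G (gmul G g h) k = gmul G g (gmul G h k)) \<and>
     (\<forall>g. ginv G (ginv G g) = g \<and> (ginv G g, g) \<in> composable G) \<and>
     (\<forall>g h. (g, h) \<in> composable G \<longrightarrow>
        gmul G (ginv G g) (gmul G g h) = h \<and> gmul G (gmul G g h) (ginv G h) = g)"

text \<open>
  Total space modelled on \<open>'a \<times> 'b\<close>, unit space on \<open>'a\<close>; thus \<open>'b\<close> has the dimension of the fibres
  of the Lie algebroid. The topology of the manifold is the one of the type \<open>'g\<close>.
\<close>

definition unit_atlas ::
  "('g::topological_space, 'a::real_normed_vector \<times> 'b::real_normed_vector) groupoid_manifold \<Rightarrow>
   ('g, 'a) atlas" where
  "unit_atlas G = submanifold_atlas (gatlas G) (units G)"

definition lie_groupoid ::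
  "('g::{t2_space, second_countable_topology},
    'a::real_normed_vector \<times> 'b::real_normed_vector) groupoid_manifold \<Rightarrow> bool" where
  "lie_groupoid G \<longleftrightarrow>
     groupoid G \<and>
     smooth_atlas (gatlas G) \<and> carrier_of (gatlas G) = UNIV \<and>
     embedded_submanifold (gatlas G) (units G) \<and>
     submersion (gatlas G) (unit_atlas G) (rng G) \<and>
     submersion (gatlas G) (unit_atlas G) (src G) \<and>
     smooth_map_on_subset (prod_atlas (gatlas G) (gatlas G)) (gatlas G) (composable G)
       (\<lambda>(g, h). gmul G g h)"


section \<open>The Lie algebroid of a Lie groupoid\<close>

definition algebroid_fibre ::
  "('g::topological_space, 'a::real_normed_vector \<times> 'b::real_normed_vector) groupoid_manifold \<Rightarrow>
   'g \<Rightarrow> 'g tangent set" where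
  "algebroid_fibre G x =
     {v \<in> tangent_space (gatlas G) x. tangent_map (unit_atlas G) (rng G) x v = (\<lambda>h. 0)}"

definition anchor ::
  "('g::topological_space, 'a::real_normed_vector \<times> 'b::real_normed_vector) groupoid_manifold \<Rightarrow>
   'g \<Rightarrow> 'g tangent \<Rightarrow> 'g tangent" where
  "anchor G x = restrict (tangent_map (unit_atlas G) (src G) x) (algebroid_fibre G x)"

definition anchor_section ::
  "('g::topological_space, 'a::real_normed_vector \<times> 'b::real_normed_vector) groupoid_manifold \<Rightarrow>
   ('g \<Rightarrow> 'g tangent) \<Rightarrow> 'g \<Rightarrow> 'g tangent" where
  "anchor_section G \<xi> x = anchor G x (\<xi> x)"

text \<open>
  The derivative at \<open>h\<close> of left translation \<open>L\<^sub>g\<close>. Since \<open>L\<^sub>g\<close> is only defined on the fibre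
  \<open>r\<^sup>-\<^sup>1(s(g))\<close>, a tangent vector of that fibre is represented by a curve inside the fibre, and the
  curve is translated.
\<close>

definition left_translation_derivative ::
  "('g::topological_space, 'e::real_normed_vector) groupoid_manifold \<Rightarrow> 'g \<Rightarrow> 'g \<Rightarrow>
   'g tangent \<Rightarrow> 'g tangent" where
  "left_translation_derivative G g h v =
     (let \<gamma> = (SOME \<gamma>. (\<exists>\<delta>>0. smooth_map euclid (gatlas G) {-\<delta><..<\<delta>} \<gamma> \<and>
                              (\<forall>t\<in>{-\<delta><..<\<delta>}. rng G (\<gamma> t) = src G g)) \<and>
                     \<gamma> 0 = h \<and> velocity (gatlas G) \<gamma> = v)
      in velocity (gatlas G) (\<lambda>t. gmul G g (\<gamma> t)))"

definition left_invariant_extension ::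
  "('g::topological_space, 'e::real_normed_vector) groupoid_manifold \<Rightarrow>
   ('g \<Rightarrow> 'g tangent) \<Rightarrow> 'g \<Rightarrow> 'g tangent" where
  "left_invariant_extension G \<xi> g = left_translation_derivative G g (src G g) (\<xi> (src G g))"

text \<open>
  Brackets of vector fields are local. Hence this also gives, at points \<open>x \<in> W\<close>, the bracket of
  sections over an open set \<open>W\<close> of units, extended arbitrarily to functions on \<open>'g\<close>; the
  left-invariant vector fields in question are then defined over \<open>s\<^sup>-\<^sup>1(W)\<close>.
\<close>

definition algebroid_bracket ::
  "('g::topological_space, 'e::real_normed_vector) groupoid_manifold \<Rightarrow>
   ('g \<Rightarrow> 'g tangent) \<Rightarrow> ('g \<Rightarrow> 'g tangent) \<Rightarrow> 'g \<Rightarrow> 'g tangent" where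
  "algebroid_bracket G \<xi> \<eta> x =
     lie_bracket (gatlas G) (left_invariant_extension G \<xi>) (left_invariant_extension G \<eta>) x"


section \<open>Adapted charts and local data\<close>

definition adapted_charts ::
  "('g::topological_space, 'a::real_normed_vector \<times> 'b::real_normed_vector) groupoid_manifold \<Rightarrow>
   'a set \<Rightarrow> 'b set \<Rightarrow> ('a \<times> 'b \<Rightarrow> 'g) \<Rightarrow> ('a \<Rightarrow> 'g) \<Rightarrow> 'g \<Rightarrow> bool" where
  "adapted_charts G U V \<psi> \<phi> x0 \<longleftrightarrow>
     open U \<and> 0 \<in> U \<and> open V \<and> 0 \<in> V \<and>
     diffeo_onto_open euclid (gatlas G) (U \<times> V) \<psi> \<and>
     diffeo_onto_open euclid (unit_atlas G) U \<phi> \<and>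
     \<psi> (0, 0) = x0 \<and>
     (\<forall>u\<in>U. \<forall>v\<in>V. rng G (\<psi> (u, v)) = \<phi> u) \<and>
     \<psi> ` (U \<times> {0}) = \<psi> ` (U \<times> V) \<inter> units G"

text \<open>The section \<open>\<phi>(u) \<mapsto> (\<partial>\<psi>/\<partial>v)(u,0) w\<close> over \<open>\<phi>(U)\<close>; the frame is obtained for \<open>w = f\<^sub>i\<close>.\<close>

definition frame ::
  "('g::topological_space, 'a::real_normed_vector \<times> 'b::real_normed_vector) groupoid_manifold \<Rightarrow>
   'a set \<Rightarrow> ('a \<times> 'b \<Rightarrow> 'g) \<Rightarrow> ('a \<Rightarrow> 'g) \<Rightarrow> (nat \<Rightarrow> 'b) \<Rightarrow> nat \<Rightarrow> 'g \<Rightarrow> 'g tangent" where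
  "frame G U \<psi> \<phi> f i x = velocity (gatlas G) (\<lambda>t. \<psi> (inv_into U \<phi> x, t *\<^sub>R f i))"

definition coord :: "'a::real_inner set \<Rightarrow> ('a \<Rightarrow> 'g) \<Rightarrow> (nat \<Rightarrow> 'a) \<Rightarrow> nat \<Rightarrow> 'g \<Rightarrow> real" where
  "coord U \<phi> \<epsilon> j x = inv_into U \<phi> x \<bullet> \<epsilon> j"

text \<open>
  \<open>sigma_map\<close> is meaningful on the open set \<open>D\<close> of those \<open>(u, v)\<close> with \<open>s(\<psi>(u,v)) \<in> \<phi>(U)\<close>,
  and \<open>product_map\<close> where the product below lies in \<open>\<psi>(U \<times> V)\<close>. They enter the statement only
  through their germs at \<open>(u, 0)\<close> and \<open>(u, 0, 0)\<close>.
\<close>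

definition sigma_map ::
  "('g, 'a \<times> 'b) groupoid_manifold \<Rightarrow> 'a set \<Rightarrow> ('a \<times> 'b \<Rightarrow> 'g) \<Rightarrow> ('a \<Rightarrow> 'g) \<Rightarrow> 'a \<Rightarrow> 'b \<Rightarrow> 'a" where
  "sigma_map G U \<psi> \<phi> u v = inv_into U \<phi> (src G (\<psi> (u, v)))"

definition product_map ::
  "('g, 'a \<times> 'b) groupoid_manifold \<Rightarrow> 'a set \<Rightarrow> 'b set \<Rightarrow> ('a \<times> 'b \<Rightarrow> 'g) \<Rightarrow> ('a \<Rightarrow> 'g) \<Rightarrow>
   'a \<Rightarrow> 'b \<Rightarrow> 'b \<Rightarrow> 'b" where
  "product_map G U V \<psi> \<phi> u v w =
     (THE z. z \<in> V \<and> gmul G (\<psi> (u, v)) (\<psi> (sigma_map G U \<psi> \<phi> u v, w)) = \<psi> (u, z))"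

definition product_expansion ::
  "('g, 'a \<times> 'b::real_normed_vector) groupoid_manifold \<Rightarrow> 'a set \<Rightarrow> 'b set \<Rightarrow> ('a \<times> 'b \<Rightarrow> 'g) \<Rightarrow>
   ('a \<Rightarrow> 'g) \<Rightarrow> ('a \<Rightarrow> 'b \<Rightarrow> 'b \<Rightarrow> 'b) \<Rightarrow> bool" where
  "product_expansion G U V \<psi> \<phi> B \<longleftrightarrow>
     (\<forall>u\<in>U. bilinear (B u) \<and>
        (\<lambda>(v, w). norm (product_map G U V \<psi> \<phi> u v w - (v + w + B u v w)))
          \<in> O[at (0, 0)](\<lambda>(v, w). norm (v, w) ^ 3))"

definition structure_a ::
  "('g::topological_space, 'a::real_inner \<times> 'b::real_normed_vector) groupoid_manifold \<Rightarrow>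
   'a set \<Rightarrow> ('a \<times> 'b \<Rightarrow> 'g) \<Rightarrow> ('a \<Rightarrow> 'g) \<Rightarrow> (nat \<Rightarrow> 'a) \<Rightarrow> (nat \<Rightarrow> 'b) \<Rightarrow>
   nat \<Rightarrow> nat \<Rightarrow> 'g \<Rightarrow> real" where
  "structure_a G U \<psi> \<phi> \<epsilon> f i j x =
     anchor_section G (frame G U \<psi> \<phi> f i) x (coord U \<phi> \<epsilon> j)"

text \<open>
  The coefficients of the bracket with respect to the frame. The vanishing condition outside
  \<open>{1..m}\<close> only serves to make the coefficient function unique.
\<close>

definition structure_c ::
  "('g::topological_space, 'a::real_normed_vector \<times> 'b::real_normed_vector) groupoid_manifold \<Rightarrow>
   'a set \<Rightarrow> ('a \<times> 'b \<Rightarrow> 'g) \<Rightarrow> ('a \<Rightarrow> 'g) \<Rightarrow> nat \<Rightarrow> (nat \<Rightarrow> 'b) \<Rightarrow>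
   nat \<Rightarrow> nat \<Rightarrow> nat \<Rightarrow> 'g \<Rightarrow> real" where
  "structure_c G U \<psi> \<phi> m f i j k x =
     (THE c. (\<forall>l. l \<notin> {1..m} \<longrightarrow> c l = 0) \<and>
        algebroid_bracket G (frame G U \<psi> \<phi> f i) (frame G U \<psi> \<phi> f j) x =
          (\<lambda>h. \<Sum>l=1..m. c l * frame G U \<psi> \<phi> f l x h)) k"

end

theory Submission
  imports Defs
begin

text \<open>
  In the chart \<open>\<psi>\<close>, left translation of the curve \<open>t \<mapsto> \<psi>(\<sigma>(z), t w)\<close> by \<open>\<psi>(z)\<close> is a smooth map
  \<open>T\<^sub>w(z, t)\<close>, so for a germ \<open>h\<close> and \<open>H = h \<circ> \<psi>\<close> the left-invariant field \<open>X\<^sub>w\<close> extending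
  \<open>\<partial>\<psi>/\<partial>v w\<close> acts by \<open>X\<^sub>w h (\<psi>(z)) = \<partial>\<^sub>t H(T\<^sub>w(z, t))\<close> at \<open>t = 0\<close>. As \<open>T\<^sub>w((u, s v), t) = (u, p(u, s v, t w))\<close>,
  the value of \<open>X\<^sub>v(X\<^sub>w h)\<close> at \<open>\<psi>(u, 0)\<close> is the mixed second derivative at \<open>0\<close> of \<open>H(u, p(u, s v, t w))\<close>, that is, the limit of
  \<open>(H(u, p(u, s v, s w)) - H(u, s v) - H(u, s w) + H(u, 0)) / s\<^sup>2\<close>. In the bracket \<open>[X\<^sub>v, X\<^sub>w]\<close> only
  \<open>(H(u, p(u, s v, s w)) - H(u, p(u, s w, s v))) / s\<^sup>2\<close> survives, whose limit is the derivative of \<open>H\<close> at \<open>(u, 0)\<close>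
  in the direction \<open>(0, B(u, v, w) - B(u, w, v))\<close> by the expansion of \<open>p\<close>. Evaluating on the coordinates
  of \<open>v\<close> gives the structure functions.
\<close>

section \<open>Smooth maps between normed spaces\<close>

text \<open>Two obstacles shape the proof. The expansion of \<open>p\<close> bounds only the size of
  its remainder and says nothing about derivatives, so the second derivatives in a bracket are first
  turned into finite differences, where only values of \<open>p\<close> occur. With both increments
  scaled by the same \<open>s\<close> the bilinear term has order exactly s^2 and the cubic
  remainder vanishes after division by s^2. The two points then compared differ by O(s^2), but are
  only O(s) close to (u, 0); hence a mean value argument near (u, 0) instead of the derivative at
  that point.

  Secondly, left translation by g lives on a single r-fibre, multiplication is smooth only through
  local extensions off the composable pairs, and its derivative is taken along a curve that is
  chosen, not given. A smooth chart expression \<open>\<Theta>\<close> of such an extension is fixed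
  near a unit. It may be wrong off the composable pairs, but the curves it is applied to stay in the
  fibre where it is right. Since tangent vectors are 0 by convention on functions that are not
  germs, every evaluation also needs a proof that its argument is smooth.\<close>

lemma Ck_on_cong:
  assumes "open S" "\<And>x. x \<in> S \<Longrightarrow> f x = g x" "Ck_on k S f"
  shows "Ck_on k S g"
  using assms(2,3)
proof (induction k arbitrary: f g)
  case 0
  then show ?case using continuous_on_cong[of S S f g] by simp
next
  case (Suc k)
  have deriv: "(g has_derivative frechet_derivative f (at x)) (at x)" if "x \<in> S" for x
  proof (rule has_derivative_transform_within_open[OF _ assms(1) that])
    show "(f has_derivative frechet_derivative f (at x)) (at x)"
      using Suc.prems(2) that by (auto simp: frechet_derivative_works[symmetric])
  qed (use Suc.prems(1) in auto)
  have "Ck_on k S (\<lambda>x. frechet_derivative g (at x) v)" for v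
  proof (rule Suc.IH)
    show "frechet_derivative f (at x) v = frechet_derivative g (at x) v" if "x \<in> S" for x
      using frechet_derivative_at[OF deriv[OF that]] by simp
    show "Ck_on k S (\<lambda>x. frechet_derivative f (at x) v)"
      using Suc.prems(2) by simp
  qed
  then show ?case
    using deriv unfolding Ck_on.simps differentiable_def by blast
qed

text \<open>Derivatives at a point are unique, so any explicit formula may stand in for the choice
  \<open>frechet_derivative\<close>. The closure properties below rest on this.\<close>

lemma Ck_on_Suc_intro:
  assumes "open S" and deriv: "\<And>x. x \<in> S \<Longrightarrow> (f has_derivative f' x) (at x)"
    and "\<And>v. Ck_on k S (\<lambda>x. f' x v)"
  shows "Ck_on (Suc k) S f"
proof -
  have "f' x = frechet_derivative f (at x)" if "x \<in> S" for x
    using deriv[OF that] frechet_derivative_at by blast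
  then have "Ck_on k S (\<lambda>x. frechet_derivative f (at x) v)" for v
    using assms(3)[of v] Ck_on_cong[OF assms(1), of "\<lambda>x. f' x v"] by simp
  then show ?thesis
    using deriv by (auto simp: differentiable_def)
qed

lemma Ck_on_has_derivative:
  "Ck_on (Suc k) S f \<Longrightarrow> x \<in> S \<Longrightarrow> (f has_derivative frechet_derivative f (at x)) (at x)"
  by (auto simp: frechet_derivative_works[symmetric])

lemma Ck_on_subset: "Ck_on k S f \<Longrightarrow> T \<subseteq> S \<Longrightarrow> Ck_on k T f"
  by (induction k arbitrary: f) (auto intro: continuous_on_subset)

lemma Ck_on_lower: "Ck_on (Suc k) S f \<Longrightarrow> Ck_on k S f"
proof (induction k arbitrary: f)
  case 0
  then show ?case
    by (auto intro!: continuous_at_imp_continuous_on differentiable_imp_continuous_within)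
qed auto

lemma Ck_on_const: "Ck_on k S (\<lambda>x. c)"
  by (induction k arbitrary: c) auto

lemma Ck_on_bounded_linear:
  assumes "open S" "bounded_linear L" "Ck_on k S f"
  shows "Ck_on k S (\<lambda>x. L (f x))"
  using assms(3)
proof (induction k arbitrary: f)
  case 0
  then show ?case
    using assms(2) by (simp add: bounded_linear.continuous_on)
next
  case (Suc k)
  show ?case
    by (rule Ck_on_Suc_intro[OF assms(1)
          bounded_linear.has_derivative[OF assms(2) Ck_on_has_derivative[OF Suc.prems]]])
      (use Suc in auto)
qed

lemma Ck_on_ident: "open S \<Longrightarrow> Ck_on k S (\<lambda>x. x)"
proof (cases k)
  case (Suc k)
  assume S: "open S"
  show ?thesis
    unfolding Suc by (rule Ck_on_Suc_intro[OF S has_derivative_ident]) (simp add: Ck_on_const)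
qed simp

lemma Ck_on_add:
  assumes "open S" "Ck_on k S f" "Ck_on k S g"
  shows "Ck_on k S (\<lambda>x. f x + g x)"
  using assms(2,3)
proof (induction k arbitrary: f g)
  case 0
  then show ?case by (simp add: continuous_on_add)
next
  case (Suc k)
  show ?case
    by (rule Ck_on_Suc_intro[OF assms(1)
          has_derivative_add[OF Ck_on_has_derivative[OF Suc.prems(1)] Ck_on_has_derivative[OF Suc.prems(2)]]])
      (use Suc in auto)
qed

lemma Ck_on_sum:
  "open S \<Longrightarrow> (\<And>i. i \<in> I \<Longrightarrow> Ck_on k S (f i)) \<Longrightarrow> Ck_on k S (\<lambda>x. \<Sum>i\<in>I. f i x)"
  by (induction I rule: infinite_finite_induct) (auto intro: Ck_on_const Ck_on_add)

lemma Ck_on_scaleR: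
  assumes "open S" "Ck_on k S f" "Ck_on k S g"
  shows "Ck_on k S (\<lambda>x. f x *\<^sub>R g x)"
  using assms(2,3)
proof (induction k arbitrary: f g)
  case 0
  then show ?case by (simp add: continuous_on_scaleR)
next
  case (Suc k)
  \<comment> \<open>The Leibniz rule leaves one factor undifferentiated, so both functions must also
    be lowered to order \<open>k\<close>.\<close>
  have "Ck_on k S (\<lambda>x. f x *\<^sub>R frechet_derivative g (at x) v + frechet_derivative f (at x) v *\<^sub>R g x)" for v
    using Suc.prems by (intro Ck_on_add Suc.IH assms(1) Ck_on_lower[of k S f] Ck_on_lower[of k S g]) auto
  then show ?case
    by (intro Ck_on_Suc_intro[OF assms(1)
          has_derivative_scaleR[OF Ck_on_has_derivative[OF Suc.prems(1)] Ck_on_has_derivative[OF Suc.prems(2)]]])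
qed

lemma Ck_on_Pair:
  assumes "open S" "Ck_on k S f" "Ck_on k S g"
  shows "Ck_on k S (\<lambda>x. (f x, g x))"
  using Ck_on_add[OF assms(1)
      Ck_on_bounded_linear[OF assms(1) bounded_linear_Pair[OF bounded_linear_ident bounded_linear_zero] assms(2)]
      Ck_on_bounded_linear[OF assms(1) bounded_linear_Pair[OF bounded_linear_zero bounded_linear_ident] assms(3)]]
  by simp

text \<open>
  With smoothness defined through directional derivatives, the chain rule needs coordinates in the
  middle space. The class \<^class>\<open>euclidean_space\<close> is not available, since dimension \<open>0\<close> is allowed.
\<close>

definition findim :: "'v::real_inner itself \<Rightarrow> bool" where
  "findim _ \<longleftrightarrow> (\<exists>S::'v set. finite S \<and> (\<forall>x. x = (\<Sum>b\<in>S. (x \<bullet> b) *\<^sub>R b)))"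

lemma findim_real: "findim TYPE(real)"
  unfolding findim_def by (rule exI[of _ "{1}"]) auto

lemma findim_prod:
  assumes "findim TYPE('v::real_inner)" "findim TYPE('w::real_inner)"
  shows "findim TYPE('v \<times> 'w)"
proof -
  obtain S :: "'v set" where S: "finite S" "\<And>x. x = (\<Sum>b\<in>S. (x \<bullet> b) *\<^sub>R b)"
    using assms(1) unfolding findim_def by blast
  obtain T :: "'w set" where T: "finite T" "\<And>x. x = (\<Sum>b\<in>T. (x \<bullet> b) *\<^sub>R b)"
    using assms(2) unfolding findim_def by blast
  \<comment> \<open>Zero vectors are removed because (0, 0) would otherwise lie in both images and
    be counted in only one of the two sums.\<close>
  let ?S = "(\<lambda>b. (b, 0::'w)) ` (S - {0})" and ?T = "(\<lambda>b. (0::'v, b)) ` (T - {0})"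
  have disj: "?S \<inter> ?T = {}" by auto
  have "z = (\<Sum>b\<in>?S \<union> ?T. (z \<bullet> b) *\<^sub>R b)" for z :: "'v \<times> 'w"
  proof -
    obtain x y where z: "z = (x, y)" by fastforce
    have "(\<Sum>b\<in>?S. (z \<bullet> b) *\<^sub>R b) = (\<Sum>b\<in>S - {0}. ((x \<bullet> b) *\<^sub>R b, 0))"
      by (subst sum.reindex) (auto simp: inj_on_def z)
    also have "\<dots> = (\<Sum>b\<in>S. ((x \<bullet> b) *\<^sub>R b, 0))"
      by (rule sum.mono_neutral_left) (use S(1) in \<open>auto simp: zero_prod_def\<close>)
    also have "\<dots> = (x, 0)"
      using S(2)[of x] by (simp add: sum_prod)
    finally have 1: "(\<Sum>b\<in>?S. (z \<bullet> b) *\<^sub>R b) = (x, 0)" .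
    have "(\<Sum>b\<in>?T. (z \<bullet> b) *\<^sub>R b) = (\<Sum>b\<in>T - {0}. (0, (y \<bullet> b) *\<^sub>R b))"
      by (subst sum.reindex) (auto simp: inj_on_def z)
    also have "\<dots> = (\<Sum>b\<in>T. (0, (y \<bullet> b) *\<^sub>R b))"
      by (rule sum.mono_neutral_left) (use T(1) in \<open>auto simp: zero_prod_def\<close>)
    also have "\<dots> = (0, y)"
      using T(2)[of y] by (simp add: sum_prod)
    finally show ?thesis
      using 1 S(1) T(1) disj by (simp add: sum.union_disjoint z)
  qed
  then show ?thesis
    unfolding findim_def using S(1) T(1) by (intro exI[of _ "?S \<union> ?T"]) auto
qed

text \<open>The difference of the two sides is orthogonal to every basis vector and lies in their
  span, so it is orthogonal to itself.\<close>

lemma canonical_basis_expansion: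
  assumes "canonical_basis n b"
  shows "x = (\<Sum>i=1..n. (x \<bullet> b i) *\<^sub>R b i)"
proof -
  have orth: "b i \<bullet> b j = (if i = j then 1 else 0)" if "i \<in> {1..n}" "j \<in> {1..n}" for i j
    using assms that unfolding canonical_basis_def by blast
  let ?d = "x - (\<Sum>i=1..n. (x \<bullet> b i) *\<^sub>R b i)"
  have "?d \<bullet> b j = 0" if "j \<in> {1..n}" for j
  proof -
    have "(\<Sum>i=1..n. (x \<bullet> b i) *\<^sub>R b i) \<bullet> b j = (\<Sum>i=1..n. (x \<bullet> b i) * (b i \<bullet> b j))"
      by (simp add: inner_sum_left)
    also have "\<dots> = (\<Sum>i=1..n. if i = j then x \<bullet> b i else 0)"
      using that orth by (intro sum.cong) auto
    finally show ?thesis using that by (simp add: inner_diff_left)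
  qed
  moreover have "?d \<in> span (b ` {1..n})"
    using assms unfolding canonical_basis_def by simp
  ultimately have "?d \<bullet> ?d = 0"
    using orthogonal_to_span[of ?d "b ` {1..n}" ?d] unfolding orthogonal_def by blast
  then show ?thesis by (simp only: inner_eq_zero_iff right_minus_eq)
qed

lemma canonical_basis_inj_on:
  assumes "canonical_basis n b"
  shows "inj_on b {1..n}"
proof (rule inj_onI)
  fix i j assume ij: "i \<in> {1..n}" "j \<in> {1..n}" and eq: "b i = b j"
  have "b i \<bullet> b j = (if i = j then 1 else 0)" "b j \<bullet> b j = (if j = j then 1 else 0)"
    using assms ij unfolding canonical_basis_def by blast+
  with eq show "i = j" by (auto split: if_splits)
qed

lemma canonical_basis_imp_findim:
  assumes "canonical_basis n (b :: nat \<Rightarrow> 'v::real_inner)"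
  shows "findim TYPE('v)"
proof -
  have "x = (\<Sum>c\<in>b ` {1..n}. (x \<bullet> c) *\<^sub>R c)" for x
    using canonical_basis_expansion[OF assms, of x] canonical_basis_inj_on[OF assms]
    by (simp add: sum.reindex)
  then show ?thesis unfolding findim_def by blast
qed

lemma Ck_on_compose:
  fixes f :: "'u::real_normed_vector \<Rightarrow> 'v::real_inner" and g :: "'v \<Rightarrow> 'w::real_normed_vector"
  assumes "findim TYPE('v)" "open S" "open T" "f ` S \<subseteq> T" "Ck_on k S f" "Ck_on k T g"
  shows "Ck_on k S (\<lambda>x. g (f x))"
  using assms(5,6)
proof (induction k arbitrary: g)
  case 0
  then show ?case using assms(4) by (simp add: continuous_on_compose2)
next
  case (Suc k)
  obtain I :: "'v set" where I: "\<And>x. x = (\<Sum>b\<in>I. (x \<bullet> b) *\<^sub>R b)"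
    using assms(1) unfolding findim_def by blast
  let ?df = "\<lambda>x. frechet_derivative f (at x)" and ?dg = "\<lambda>x. frechet_derivative g (at x)"
  have deriv: "((\<lambda>x. g (f x)) has_derivative (\<lambda>v. ?dg (f x) (?df x v))) (at x)" if "x \<in> S" for x
    using has_derivative_compose[OF Ck_on_has_derivative[OF Suc.prems(1) that] Ck_on_has_derivative[OF Suc.prems(2)]]
      that assms(4) by blast
  show ?case
  proof (rule Ck_on_Suc_intro[OF assms(2) deriv])
    fix v
    \<comment> \<open>The direction \<open>?df x v\<close> varies with \<open>x\<close>, while the
      induction hypothesis speaks of fixed directions. Expanding it leaves scalar coefficients times
      derivatives of \<open>g\<close> in the fixed directions \<open>b\<close>.\<close>
    have "Ck_on k S (\<lambda>x. \<Sum>b\<in>I. (?df x v \<bullet> b) *\<^sub>R ?dg (f x) b)"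
    proof (intro Ck_on_sum Ck_on_scaleR assms(2))
      fix b
      show "Ck_on k S (\<lambda>x. ?df x v \<bullet> b)"
        by (rule Ck_on_bounded_linear[OF assms(2) bounded_linear_inner_left]) (use Suc.prems in simp)
      show "Ck_on k S (\<lambda>x. ?dg (f x) b)"
        by (rule Suc.IH) (use Suc.prems Ck_on_lower in auto)
    qed
    moreover have "(\<Sum>b\<in>I. (?df x v \<bullet> b) *\<^sub>R ?dg (f x) b) = ?dg (f x) (?df x v)" if "x \<in> S" for x
    proof -
      have lin: "linear (?dg (f x))"
        using Ck_on_has_derivative[OF Suc.prems(2)] that assms(4) has_derivative_linear by blast
      have "?dg (f x) (?df x v) = ?dg (f x) (\<Sum>b\<in>I. (?df x v \<bullet> b) *\<^sub>R b)"
        by (rule arg_cong[OF I])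
      then show ?thesis by (simp add: linear_sum[OF lin] linear_scale[OF lin])
    qed
    ultimately show "Ck_on k S (\<lambda>x. ?dg (f x) (?df x v))"
      by (rule Ck_on_cong[OF assms(2), rotated])
  qed
qed

text \<open>A property of the germ at \<open>z\<close>: it survives any change of \<open>f\<close>
  off a neighbourhood. Maps that are meaningful only near a point, such as chart inverses given by
  \<open>inv_into\<close>, can thus be handled through the filter \<open>nhds z\<close>.\<close>

definition smooth_at :: "('v::real_normed_vector \<Rightarrow> 'w::real_normed_vector) \<Rightarrow> 'v \<Rightarrow> bool" where
  "smooth_at f z \<longleftrightarrow> (\<exists>N. open N \<and> z \<in> N \<and> smooth_on N f)"

lemma smooth_on_imp_smooth_at: "smooth_on S f \<Longrightarrow> open S \<Longrightarrow> z \<in> S \<Longrightarrow> smooth_at f z"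
  unfolding smooth_at_def by blast

lemma smooth_at_cong:
  assumes "smooth_at f z" "\<forall>\<^sub>F x in nhds z. f x = g x"
  shows "smooth_at g z"
proof -
  obtain N where N: "open N" "z \<in> N" "smooth_on N f"
    using assms(1) unfolding smooth_at_def by blast
  obtain M where M: "open M" "z \<in> M" "\<And>x. x \<in> M \<Longrightarrow> f x = g x"
    using assms(2) unfolding eventually_nhds by blast
  have "Ck_on k (N \<inter> M) g" for k
  proof (rule Ck_on_cong)
    show "Ck_on k (N \<inter> M) f"
      using N(3) Ck_on_subset unfolding smooth_on_def by blast
  qed (use N M in auto)
  then show ?thesis
    unfolding smooth_at_def smooth_on_def using N M by (intro exI[of _ "N \<inter> M"]) auto
qed

lemma eventually_smooth_at: "smooth_at f z \<Longrightarrow> \<forall>\<^sub>F x in nhds z. smooth_at f x"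
  unfolding eventually_nhds smooth_at_def by blast

lemma smooth_at_imp_has_derivative:
  "smooth_at f z \<Longrightarrow> (f has_derivative frechet_derivative f (at z)) (at z)"
  unfolding smooth_at_def smooth_on_def using Ck_on_has_derivative by blast

lemma smooth_at_imp_isCont: "smooth_at f z \<Longrightarrow> isCont f z"
  using smooth_at_imp_has_derivative has_derivative_continuous by blast

lemma smooth_at_imp_tendsto: "smooth_at f z \<Longrightarrow> (f \<longlongrightarrow> f z) (nhds z)"
  using smooth_at_imp_isCont by (simp add: isCont_def tendsto_at_iff_tendsto_nhds)

lemma smooth_at_frechet_derivative:
  "smooth_at f z \<Longrightarrow> smooth_at (\<lambda>x. frechet_derivative f (at x) v) z"
  unfolding smooth_at_def smooth_on_def using Ck_on.simps(2) by blast

lemma smooth_at_const: "smooth_at (\<lambda>x. c) z"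
  unfolding smooth_at_def smooth_on_def using Ck_on_const open_UNIV by blast

lemma smooth_at_ident: "smooth_at (\<lambda>x. x) z"
  unfolding smooth_at_def smooth_on_def using Ck_on_ident open_UNIV by blast

lemma smooth_at_bounded_linear:
  "bounded_linear L \<Longrightarrow> smooth_at f z \<Longrightarrow> smooth_at (\<lambda>x. L (f x)) z"
  unfolding smooth_at_def smooth_on_def using Ck_on_bounded_linear by blast

lemma smooth_at_compose:
  fixes f :: "'u::real_normed_vector \<Rightarrow> 'v::real_inner" and g :: "'v \<Rightarrow> 'w::real_normed_vector"
  assumes "findim TYPE('v)" "smooth_at f z" "smooth_at g (f z)"
  shows "smooth_at (\<lambda>x. g (f x)) z"
proof -
  obtain M where M: "open M" "f z \<in> M" "smooth_on M g"
    using assms(3) unfolding smooth_at_def by blast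
  obtain N where N: "open N" "z \<in> N" "smooth_on N f"
    using assms(2) unfolding smooth_at_def by blast
  have "\<forall>\<^sub>F x in nhds z. f x \<in> M"
    using smooth_at_imp_tendsto[OF assms(2)] M by (auto dest: topological_tendstoD)
  then obtain P where P: "open P" "z \<in> P" "\<And>x. x \<in> P \<Longrightarrow> f x \<in> M"
    unfolding eventually_nhds by blast
  have "Ck_on k (N \<inter> P) (\<lambda>x. g (f x))" for k
  proof (rule Ck_on_compose[OF assms(1) _ M(1)])
    show "Ck_on k (N \<inter> P) f"
      using N(3) Ck_on_subset unfolding smooth_on_def by blast
  qed (use N P M in \<open>auto simp: smooth_on_def\<close>)
  then show ?thesis
    unfolding smooth_at_def smooth_on_def using N P by (intro exI[of _ "N \<inter> P"]) auto
qed

lemma smooth_at_binary: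
  assumes "\<And>k S. open S \<Longrightarrow> Ck_on k S f \<Longrightarrow> Ck_on k S g \<Longrightarrow> Ck_on k S h"
    and "smooth_at f z" "smooth_at g z"
  shows "smooth_at h z"
proof -
  obtain M where M: "open M" "z \<in> M" "smooth_on M f"
    using assms(2) unfolding smooth_at_def by blast
  obtain N where N: "open N" "z \<in> N" "smooth_on N g"
    using assms(3) unfolding smooth_at_def by blast
  have "Ck_on k (M \<inter> N) h" for k
    by (rule assms(1)) (use M N Ck_on_subset[of k M f "M \<inter> N"] Ck_on_subset[of k N g "M \<inter> N"]
        in \<open>auto simp: smooth_on_def\<close>)
  then show ?thesis
    unfolding smooth_at_def smooth_on_def using M N by (intro exI[of _ "M \<inter> N"]) auto
qed

lemma smooth_at_add: "smooth_at f z \<Longrightarrow> smooth_at g z \<Longrightarrow> smooth_at (\<lambda>x. f x + g x) z"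
  by (rule smooth_at_binary[where f = f and g = g]) (auto intro: Ck_on_add)

lemma smooth_at_scaleR: "smooth_at f z \<Longrightarrow> smooth_at g z \<Longrightarrow> smooth_at (\<lambda>x. f x *\<^sub>R g x) z"
  by (rule smooth_at_binary[where f = f and g = g]) (auto intro: Ck_on_scaleR)

lemma smooth_at_mult:
  "smooth_at f z \<Longrightarrow> smooth_at g z \<Longrightarrow> smooth_at (\<lambda>x. f x * g x :: real) z"
  using smooth_at_scaleR[of f z g] by simp

lemma smooth_at_Pair: "smooth_at f z \<Longrightarrow> smooth_at g z \<Longrightarrow> smooth_at (\<lambda>x. (f x, g x)) z"
  by (rule smooth_at_binary[where f = f and g = g]) (auto intro: Ck_on_Pair)

lemma smooth_at_fst: "smooth_at f z \<Longrightarrow> smooth_at (\<lambda>x. fst (f x)) z"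
  by (rule smooth_at_bounded_linear[OF bounded_linear_fst])

lemma smooth_at_snd: "smooth_at f z \<Longrightarrow> smooth_at (\<lambda>x. snd (f x)) z"
  by (rule smooth_at_bounded_linear[OF bounded_linear_snd])

text \<open>Differentiability and directional derivatives at a point depend on the germ only. This
  leads from \<open>smooth_at\<close> back to the \<open>smooth_on\<close> that
  \<open>smooth_map\<close> asks for, although the neighbourhoods vary with the point.\<close>

lemma Ck_on_local:
  assumes "\<And>z. z \<in> S \<Longrightarrow> \<exists>N. open N \<and> z \<in> N \<and> Ck_on k N f"
  shows "Ck_on k S f"
  using assms
proof (induction k arbitrary: f)
  case 0
  have "isCont f z" if "z \<in> S" for z
    using 0[OF that] continuous_on_eq_continuous_at by auto
  then show ?case by (simp add: continuous_at_imp_continuous_on)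
next
  case (Suc k)
  have "Ck_on k S (\<lambda>x. frechet_derivative f (at x) v)" for v
  proof (rule Suc.IH)
    fix z assume "z \<in> S"
    then show "\<exists>N. open N \<and> z \<in> N \<and> Ck_on k N (\<lambda>x. frechet_derivative f (at x) v)"
      using Suc.prems[of z] by auto
  qed
  moreover have "f differentiable at x" if "x \<in> S" for x
    using Suc.prems[OF that] by auto
  ultimately show ?case by simp
qed

lemma smooth_on_if_smooth_at: "(\<And>z. z \<in> S \<Longrightarrow> smooth_at f z) \<Longrightarrow> smooth_on S f"
  unfolding smooth_at_def smooth_on_def by (intro allI Ck_on_local) blast

section \<open>Smoothness on manifolds in terms of parametrisations and functions\<close>

text \<open>Smoothness at a point of a map into the manifold. Convergence is required separately,
  since smoothness of \<open>c \<circ> F\<close> does not prevent \<open>F\<close> from leaving the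
  chart domain arbitrarily close to \<open>z\<close>.\<close>

definition smooth_param ::
  "('p::topological_space, 'e::real_normed_vector) atlas \<Rightarrow> ('v::real_normed_vector \<Rightarrow> 'p) \<Rightarrow> 'v \<Rightarrow> bool" where
  "smooth_param A F z \<longleftrightarrow>
     (F \<longlongrightarrow> F z) (nhds z) \<and> (\<forall>(D, c)\<in>A. F z \<in> D \<longrightarrow> smooth_at (\<lambda>x. c (F x)) z)"

text \<open>The counterpart for maps out of the manifold. A parametrisation followed by an
  observable is a map between vector spaces (\<open>smooth_at_obs_param\<close>), so most later
  arguments avoid charts of the atlas.\<close>

definition smooth_obs ::
  "('p::topological_space, 'e::real_normed_vector) atlas \<Rightarrow> ('p \<Rightarrow> 'w::real_normed_vector) \<Rightarrow> 'p \<Rightarrow> bool" where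
  "smooth_obs A g y \<longleftrightarrow> (\<forall>(D, c)\<in>A. y \<in> D \<longrightarrow> smooth_at (\<lambda>x. g (inv_into D c x)) (c y))"

lemma open_in_euclid: "open_in euclid W \<longleftrightarrow> open W"
  by (simp add: open_in_def euclid_def carrier_of_def)

lemma smooth_param_tendsto: "smooth_param A F z \<Longrightarrow> (F \<longlongrightarrow> F z) (nhds z)"
  unfolding smooth_param_def by blast

lemma smooth_param_eventually:
  "smooth_param A F z \<Longrightarrow> open W \<Longrightarrow> F z \<in> W \<Longrightarrow> \<forall>\<^sub>F x in nhds z. F x \<in> W"
  by (blast dest: smooth_param_tendsto topological_tendstoD)

lemma smooth_param_atlas:
  "smooth_param A F z \<Longrightarrow> (D, c) \<in> A \<Longrightarrow> F z \<in> D \<Longrightarrow> smooth_at (\<lambda>x. c (F x)) z"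
  unfolding smooth_param_def by blast

lemma smooth_obs_atlas:
  "smooth_obs A g y \<Longrightarrow> (D, c) \<in> A \<Longrightarrow> y \<in> D \<Longrightarrow> smooth_at (\<lambda>x. g (inv_into D c x)) (c y)"
  unfolding smooth_obs_def by blast

section \<open>Charts, germs and velocities on a manifold\<close>

locale smooth_manifold =
  fixes A :: "('p::topological_space, 'e::real_inner) atlas"
  assumes atlas: "smooth_atlas A"
    and carrier: "carrier_of A = UNIV"
    and findim: "findim TYPE('e)"
begin

lemma open_in_iff: "open_in A W \<longleftrightarrow> open W"
  by (simp add: open_in_def carrier)

text \<open>Slice charts of a submanifold are only known to lie in the maximal atlas. The chart
  lemmas are therefore proved there and reach the charts of \<open>A\<close> through this
  inclusion.\<close>

lemma atlas_subset_maximal: "A \<subseteq> maximal_atlas A"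
  using atlas unfolding smooth_atlas_def maximal_atlas_def by blast

lemma chart_at: obtains D c where "(D, c) \<in> A" "y \<in> D"
proof -
  have "y \<in> \<Union> (fst ` A)"
    using carrier unfolding carrier_of_def by simp
  then obtain C where "C \<in> A" "y \<in> fst C" by blast
  then show ?thesis
    using that[of "fst C" "snd C"] by simp
qed

context
  fixes D c
  assumes C: "(D, c) \<in> maximal_atlas A"
begin

lemma chart_homeomorphism: "homeomorphism D (c ` D) c (inv_into D c)"
  and chart_open_domain: "open D"
  and chart_open_image: "open (c ` D)"
  using C unfolding maximal_atlas_def is_chart_def carrier by auto

lemma chart_inv: "y \<in> D \<Longrightarrow> inv_into D c (c y) = y"
  using chart_homeomorphism unfolding homeomorphism_def by blast

lemma chart_inv_tendsto:
  assumes "y \<in> D"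
  shows "(inv_into D c \<longlongrightarrow> y) (nhds (c y))"
proof -
  have "isCont (inv_into D c) (c y)"
    using chart_homeomorphism assms chart_open_image
    unfolding homeomorphism_def by (meson continuous_on_eq_continuous_at image_eqI)
  then show ?thesis
    using chart_inv[OF assms] tendsto_at_iff_tendsto_nhds[of "inv_into D c" "c y"]
    by (simp add: isCont_def)
qed

lemma chart_open_image_subset:
  assumes "open W"
  shows "open (c ` (D \<inter> W))"
proof -
  have "c ` (D \<inter> W) = c ` D \<inter> inv_into D c -` W"
    using chart_inv by force
  then show ?thesis
    using continuous_open_preimage[OF _ chart_open_image assms] chart_homeomorphism
    unfolding homeomorphism_def by metis
qed

lemma smooth_at_transition:
  assumes "(D', c') \<in> A" "y \<in> D" "y \<in> D'"
  shows "smooth_at (\<lambda>x. c' (inv_into D c x)) (c y)"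
proof -
  have "open D'"
    using assms(1) atlas carrier unfolding smooth_atlas_def is_chart_def by auto
  then have op: "open (c ` (D \<inter> D'))"
    by (rule chart_open_image_subset)
  have "compatible (D, c) (D', c')"
    using C assms(1) unfolding maximal_atlas_def by blast
  then have "smooth_on (c ` (D \<inter> D')) (\<lambda>x. c' (inv_into D c x))"
    unfolding compatible_def by (simp add: comp_def)
  then show ?thesis
    by (rule smooth_on_imp_smooth_at[OF _ op]) (use assms in auto)
qed

end

text \<open>One chart suffices, possibly a slice chart: near \<open>z\<close> the map is the inverse
  chart applied to \<open>c \<circ> F\<close>, which gives continuity, and smooth transitions give
  all charts of the atlas.\<close>

lemma smooth_paramI:
  assumes C: "(D, c) \<in> maximal_atlas A" and ev: "\<forall>\<^sub>F x in nhds z. F x \<in> D"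
    and sm: "smooth_at (\<lambda>x. c (F x)) z"
  shows "smooth_param A F z"
proof -
  have z: "F z \<in> D" using eventually_nhds_x_imp_x[OF ev] .
  have eq: "\<forall>\<^sub>F x in nhds z. inv_into D c (c (F x)) = F x"
    using ev by eventually_elim (rule chart_inv[OF C])
  have lim: "((\<lambda>x. inv_into D c (c (F x))) \<longlongrightarrow> F z) (nhds z)"
    by (rule filterlim_compose[OF chart_inv_tendsto[OF C z] smooth_at_imp_tendsto[OF sm]])
  have "smooth_at (\<lambda>x. c' (F x)) z" if C': "(D', c') \<in> A" "F z \<in> D'" for D' c'
  proof -
    have "smooth_at (\<lambda>x. c' (inv_into D c (c (F x)))) z"
      by (rule smooth_at_compose[OF findim sm]) (rule smooth_at_transition[OF C C'(1) z C'(2)])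
    then show ?thesis
      by (rule smooth_at_cong) (use eq in \<open>auto elim: eventually_mono\<close>)
  qed
  moreover have "(F \<longlongrightarrow> F z) (nhds z)"
    using lim filterlim_cong[OF refl refl eq] by metis
  ultimately show ?thesis
    unfolding smooth_param_def by blast
qed

lemma smooth_at_obs_param:
  assumes "smooth_param A F z" "smooth_obs A g (F z)"
  shows "smooth_at (\<lambda>x. g (F x)) z"
proof -
  obtain D c where C: "(D, c) \<in> A" "F z \<in> D" by (rule chart_at)
  have m: "(D, c) \<in> maximal_atlas A"
    using C atlas_subset_maximal by blast
  have "smooth_at (\<lambda>x. g (inv_into D c (c (F x)))) z"
    by (rule smooth_at_compose[OF findim smooth_param_atlas[OF assms(1) C] smooth_obs_atlas[OF assms(2) C]])
  then show ?thesis
  proof (rule smooth_at_cong)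
    show "\<forall>\<^sub>F x in nhds z. g (inv_into D c (c (F x))) = g (F x)"
      using smooth_param_eventually[OF assms(1) chart_open_domain[OF m] C(2)]
      by eventually_elim (simp add: chart_inv[OF m])
  qed
qed

lemma smooth_obsI:
  assumes C: "(D, c) \<in> A" "y \<in> D" and sm: "smooth_at (\<lambda>x. g (inv_into D c x)) (c y)"
  shows "smooth_obs A g y"
proof -
  have "smooth_at (\<lambda>x. g (inv_into D' c' x)) (c' y)" if C': "(D', c') \<in> A" "y \<in> D'" for D' c'
  proof -
    have m: "(D, c) \<in> maximal_atlas A" and m': "(D', c') \<in> maximal_atlas A"
      using C C' atlas_subset_maximal by blast+
    have "smooth_at (\<lambda>x. g (inv_into D c (c (inv_into D' c' x)))) (c' y)"
      by (rule smooth_at_compose[OF findim smooth_at_transition[OF m' C(1) C'(2) C(2)]])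
        (use sm chart_inv[OF m' C'(2)] in simp)
    then show ?thesis
    proof (rule smooth_at_cong)
      have "\<forall>\<^sub>F x in nhds (c' y). inv_into D' c' x \<in> D"
        by (rule topological_tendstoD[OF chart_inv_tendsto[OF m' C'(2)] chart_open_domain[OF m] C(2)])
      then show "\<forall>\<^sub>F x in nhds (c' y). g (inv_into D c (c (inv_into D' c' x))) = g (inv_into D' c' x)"
        by eventually_elim (simp add: chart_inv[OF m])
    qed
  qed
  then show ?thesis unfolding smooth_obs_def by blast
qed

lemma chart_neighbourhood_image:
  assumes C: "(D, c) \<in> maximal_atlas A" and Q: "open Q" "y \<in> Q" "Q \<subseteq> D"
  shows "open (c ` Q)" "c y \<in> c ` Q"
  using chart_open_image_subset[OF C Q(1)] Q by (simp_all add: Int_absorb1)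

lemma smooth_map_imp_smooth_param:
  assumes "smooth_map euclid A W F" "z \<in> W"
  shows "smooth_param A F z"
proof -
  obtain D c Q where C: "(D, c) \<in> A" and Q: "open Q" "z \<in> Q" "F ` Q \<subseteq> D"
    and sm: "smooth_on Q (\<lambda>x. c (F x))"
    using assms unfolding smooth_map_def open_in_euclid euclid_def
    by (fastforce simp: comp_def open_in_def carrier_of_def)
  show ?thesis
  proof (rule smooth_paramI)
    show "(D, c) \<in> maximal_atlas A" using C atlas_subset_maximal by blast
    show "\<forall>\<^sub>F x in nhds z. F x \<in> D"
      using eventually_nhds_in_open[OF Q(1,2)] by eventually_elim (use Q(3) in blast)
    show "smooth_at (\<lambda>x. c (F x)) z"
      by (rule smooth_on_imp_smooth_at[OF sm Q(1,2)])
  qed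
qed

lemma smooth_param_imp_smooth_map:
  assumes "open W" "\<And>z. z \<in> W \<Longrightarrow> smooth_param A F z"
  shows "smooth_map euclid A W F"
  unfolding smooth_map_def
proof (intro conjI ballI)
  show "open_in euclid W" using assms(1) by (simp add: open_in_euclid)
  fix z assume z: "z \<in> W"
  obtain D c where C: "(D, c) \<in> A" "F z \<in> D" by (rule chart_at)
  have m: "(D, c) \<in> maximal_atlas A" using C atlas_subset_maximal by blast
  obtain N where N: "open N" "z \<in> N" "\<And>x. x \<in> N \<Longrightarrow> F x \<in> D"
    using smooth_param_eventually[OF assms(2)[OF z] chart_open_domain[OF m] C(2)]
    unfolding eventually_nhds by blast
  have "smooth_on (W \<inter> N) (\<lambda>x. c (F x))"
    by (rule smooth_on_if_smooth_at) (use smooth_param_atlas[OF assms(2) C(1)] N in blast)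
  then have "open_in euclid (W \<inter> N) \<and> z \<in> W \<inter> N \<and> W \<inter> N \<subseteq> W \<inter> UNIV \<and> F ` (W \<inter> N) \<subseteq> D \<and>
      smooth_on (id ` (W \<inter> N)) (c \<circ> F \<circ> inv_into UNIV id)"
    using assms(1) N z by (auto simp: open_in_euclid comp_def)
  moreover have "(UNIV, id) \<in> euclid" by (simp add: euclid_def)
  ultimately show "\<exists>(D, c)\<in>euclid. \<exists>(D', c')\<in>A. z \<in> D \<and> F z \<in> D' \<and>
      (\<exists>Q. open_in euclid Q \<and> z \<in> Q \<and> Q \<subseteq> W \<inter> D \<and> F ` Q \<subseteq> D' \<and>
        smooth_on (c ` Q) (c' \<circ> F \<circ> inv_into D c))"
    using C by blast
qed

lemma smooth_map_imp_smooth_obs: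
  assumes "smooth_map A euclid W g" "y \<in> W"
  shows "smooth_obs A g y"
proof -
  obtain D c Q where C: "(D, c) \<in> A" "y \<in> D" and Q: "open Q" "y \<in> Q" "Q \<subseteq> D"
    and sm: "smooth_on (c ` Q) (\<lambda>x. g (inv_into D c x))"
    using assms unfolding smooth_map_def open_in_iff euclid_def by (fastforce simp: comp_def)
  have m: "(D, c) \<in> maximal_atlas A" using C atlas_subset_maximal by blast
  show ?thesis
    by (rule smooth_obsI[OF C smooth_on_imp_smooth_at[OF sm chart_neighbourhood_image[OF m Q]]])
qed

lemma smooth_obs_imp_smooth_map:
  assumes "open W" "\<And>y. y \<in> W \<Longrightarrow> smooth_obs A g y"
  shows "smooth_map A euclid W g"
  unfolding smooth_map_def
proof (intro conjI ballI)
  show "open_in A W" using assms(1) by (simp add: open_in_iff)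
  fix y assume y: "y \<in> W"
  obtain D c where C: "(D, c) \<in> A" "y \<in> D" by (rule chart_at)
  have m: "(D, c) \<in> maximal_atlas A" using C atlas_subset_maximal by blast
  have "smooth_on (c ` (W \<inter> D)) (\<lambda>x. g (inv_into D c x))"
    by (rule smooth_on_if_smooth_at) (use smooth_obs_atlas[OF assms(2) C(1)] in auto)
  then have "open_in A (W \<inter> D) \<and> y \<in> W \<inter> D \<and> W \<inter> D \<subseteq> W \<inter> D \<and> g ` (W \<inter> D) \<subseteq> UNIV \<and>
      smooth_on (c ` (W \<inter> D)) (id \<circ> g \<circ> inv_into D c)"
    using assms(1) y C chart_open_domain[OF m] by (auto simp: open_in_iff comp_def)
  moreover have "(UNIV, id) \<in> euclid" by (simp add: euclid_def)
  ultimately show "\<exists>(D, c)\<in>A. \<exists>(D', c')\<in>euclid. y \<in> D \<and> g y \<in> D' \<and>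
      (\<exists>Q. open_in A Q \<and> y \<in> Q \<and> Q \<subseteq> W \<inter> D \<and> g ` Q \<subseteq> D' \<and>
        smooth_on (c ` Q) (c' \<circ> g \<circ> inv_into D c))"
    using C by blast
qed

lemma smooth_germs_imp_smooth_obs: "h \<in> smooth_germs A y \<Longrightarrow> smooth_obs A h y"
  unfolding smooth_germs_def using smooth_map_imp_smooth_obs by blast

lemma smooth_germs_eventually:
  assumes "h \<in> smooth_germs A y"
  shows "\<forall>\<^sub>F x in nhds y. h \<in> smooth_germs A x"
proof -
  obtain W where "y \<in> W" "smooth_map A euclid W h"
    using assms unfolding smooth_germs_def by blast
  then show ?thesis
    unfolding eventually_nhds smooth_germs_def
    by (intro exI[of _ W]) (auto simp: smooth_map_def open_in_iff)
qed

lemma smooth_germs_iff: "h \<in> smooth_germs A y \<longleftrightarrow> (\<forall>\<^sub>F x in nhds y. smooth_obs A h x)"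
proof
  assume "h \<in> smooth_germs A y"
  then show "\<forall>\<^sub>F x in nhds y. smooth_obs A h x"
    using smooth_germs_eventually smooth_germs_imp_smooth_obs by (metis (mono_tags, lifting) eventually_mono)
next
  assume "\<forall>\<^sub>F x in nhds y. smooth_obs A h x"
  then obtain W where "open W" "y \<in> W" "\<And>x. x \<in> W \<Longrightarrow> smooth_obs A h x"
    unfolding eventually_nhds by blast
  then show "h \<in> smooth_germs A y"
    unfolding smooth_germs_def using smooth_obs_imp_smooth_map by blast
qed

lemma smooth_obs_cong:
  assumes "smooth_obs A g y" and ev: "\<forall>\<^sub>F x in nhds y. g x = g' x"
  shows "smooth_obs A g' y"
  unfolding smooth_obs_def
proof clarify
  fix D c assume C: "(D, c) \<in> A" "y \<in> D"
  have m: "(D, c) \<in> maximal_atlas A" using C atlas_subset_maximal by blast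
  have "\<forall>\<^sub>F x in nhds (c y). g (inv_into D c x) = g' (inv_into D c x)"
    using chart_inv_tendsto[OF m C(2)] ev unfolding filterlim_iff by blast
  with smooth_obs_atlas[OF assms(1) C] show "smooth_at (\<lambda>x. g' (inv_into D c x)) (c y)"
    by (rule smooth_at_cong)
qed

lemma smooth_obs_compose:
  fixes g :: "'p \<Rightarrow> 'v::real_inner"
  assumes "findim TYPE('v)" "smooth_obs A g y" "smooth_at k (g y)"
  shows "smooth_obs A (\<lambda>x. k (g x)) y"
  unfolding smooth_obs_def
proof clarify
  fix D c assume C: "(D, c) \<in> A" "y \<in> D"
  have "(D, c) \<in> maximal_atlas A" using C atlas_subset_maximal by blast
  then show "smooth_at (\<lambda>x. k (g (inv_into D c x))) (c y)"
    by (intro smooth_at_compose[OF assms(1) smooth_obs_atlas[OF assms(2) C]])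
      (use assms(3) C chart_inv in simp)
qed

lemma smooth_obs_tendsto:
  assumes "smooth_obs A g y"
  shows "(g \<longlongrightarrow> g y) (nhds y)"
proof -
  obtain D c where C: "(D, c) \<in> A" "y \<in> D" by (rule chart_at)
  have m: "(D, c) \<in> maximal_atlas A" using C atlas_subset_maximal by blast
  have "continuous_on D c"
    using chart_homeomorphism[OF m] unfolding homeomorphism_def by blast
  then have "(c \<longlongrightarrow> c y) (nhds y)"
    using continuous_on_tendsto_compose
    by (metis C(2) at_within_open chart_open_domain[OF m] continuous_on_def tendsto_at_iff_tendsto_nhds)
  moreover have "((\<lambda>x. g (inv_into D c x)) \<longlongrightarrow> g y) (nhds (c y))"
    using smooth_at_imp_tendsto[OF smooth_obs_atlas[OF assms C]] chart_inv[OF m C(2)] by simp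
  ultimately have "((\<lambda>x. g (inv_into D c (c x))) \<longlongrightarrow> g y) (nhds y)"
    by (rule filterlim_compose[rotated])
  moreover have "\<forall>\<^sub>F x in nhds y. g (inv_into D c (c x)) = g x"
    using eventually_nhds_in_open[OF chart_open_domain[OF m] C(2)]
    by eventually_elim (simp add: chart_inv[OF m])
  ultimately show ?thesis
    using filterlim_cong[OF refl refl] by fastforce
qed

lemma smooth_germs_lincomb:
  assumes "h \<in> smooth_germs A y" "k \<in> smooth_germs A y"
  shows "(\<lambda>x. a * h x + b * k x) \<in> smooth_germs A y"
  using assms unfolding smooth_germs_iff
  by eventually_elim
    (auto simp: smooth_obs_def intro!: smooth_at_add smooth_at_mult smooth_at_const)

lemma smooth_germs_mult:
  assumes "h \<in> smooth_germs A y" "k \<in> smooth_germs A y"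
  shows "(\<lambda>x. h x * k x) \<in> smooth_germs A y"
  using assms unfolding smooth_germs_iff
  by eventually_elim (auto simp: smooth_obs_def intro!: smooth_at_mult)

lemma DERIV_germ_param:
  assumes "smooth_param A \<gamma> (0::real)" "h \<in> smooth_germs A (\<gamma> 0)"
  shows "((\<lambda>t. h (\<gamma> t)) has_real_derivative velocity A \<gamma> h) (at 0)"
proof -
  have "(\<lambda>t. h (\<gamma> t)) differentiable (at 0)"
    using smooth_at_imp_has_derivative[OF smooth_at_obs_param[OF assms(1)]]
      smooth_germs_imp_smooth_obs[OF assms(2)] differentiable_def by blast
  then show ?thesis
    using assms(2) DERIV_deriv_iff_real_differentiable by (simp add: velocity_def comp_def)
qed

lemma velocity_eqI:
  assumes "h \<in> smooth_germs A (\<gamma> 0)" "((\<lambda>t. h (\<gamma> t)) has_real_derivative d) (at 0)"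
  shows "velocity A \<gamma> h = d"
  using assms DERIV_imp_deriv by (auto simp: velocity_def comp_def)

text \<open>The derivation rules are the sum and product rules for functions of t. Membership
  matters because \<open>anchor\<close> is restricted to \<open>algebroid_fibre\<close> and has no
  useful value outside it.\<close>

lemma velocity_in_tangent_space:
  assumes \<gamma>: "smooth_param A \<gamma> (0::real)"
  shows "velocity A \<gamma> \<in> tangent_space A (\<gamma> 0)"
proof -
  have "velocity A \<gamma> (\<lambda>y. a * h y + b * k y) = a * velocity A \<gamma> h + b * velocity A \<gamma> k"
    and "velocity A \<gamma> (\<lambda>y. h y * k y) = h (\<gamma> 0) * velocity A \<gamma> k + k (\<gamma> 0) * velocity A \<gamma> h"
    if h: "h \<in> smooth_germs A (\<gamma> 0)" and k: "k \<in> smooth_germs A (\<gamma> 0)" for h k a b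
    by (rule velocity_eqI smooth_germs_lincomb smooth_germs_mult h k
        | (rule derivative_eq_intros DERIV_germ_param[OF \<gamma>] h k | simp)+)+
  moreover have "velocity A \<gamma> h = velocity A \<gamma> k"
    if h: "h \<in> smooth_germs A (\<gamma> 0)" and k: "k \<in> smooth_germs A (\<gamma> 0)"
      and W: "open W" "\<gamma> 0 \<in> W" "\<forall>y\<in>W. h y = k y" for h k W
  proof (rule velocity_eqI[where \<gamma> = \<gamma>, OF h])
    have ev: "\<forall>\<^sub>F t in nhds 0. h (\<gamma> t) = k (\<gamma> t)"
      using smooth_param_eventually[OF \<gamma> W(1,2)] by eventually_elim (use W(3) in blast)
    show "((\<lambda>t. h (\<gamma> t)) has_real_derivative velocity A \<gamma> k) (at 0)"
      using DERIV_germ_param[OF \<gamma> k] DERIV_cong_ev[OF refl ev refl] by simp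
  qed
  ultimately show ?thesis
    unfolding tangent_space_def open_in_iff mem_Collect_eq
    by (intro conjI ballI allI impI) (blast, blast, blast, simp add: velocity_def)
qed

end

text \<open>A chart of the submanifold is the first component of a slice chart \<open>e\<close>, and
  \<open>s\<close> takes values in \<open>N\<close> near the point, so there
  \<open>e \<circ> s\<close> is that chart expression paired with 0. This makes the source map,
  smooth into the unit space, smooth as a map into the whole groupoid.\<close>

lemma smooth_param_submanifold_map:
  fixes A :: "('p::topological_space, 'a::real_inner \<times> 'b::real_inner) atlas"
  assumes "smooth_manifold A"
    and sm: "smooth_map A (submanifold_atlas A N) W s"
    and F: "smooth_param A F z" and W: "F z \<in> W"
  shows "smooth_param A (\<lambda>x. s (F x)) z"
proof -
  interpret smooth_manifold A by fact
  obtain D c D' c' Q where C: "(D, c) \<in> A" "F z \<in> D" and C': "(D', c') \<in> submanifold_atlas A N"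
    and Q: "open Q" "F z \<in> Q" "Q \<subseteq> D" "s ` Q \<subseteq> D'"
    and sm_Q: "smooth_on (c ` Q) (\<lambda>x. c' (s (inv_into D c x)))"
    using sm W unfolding smooth_map_def open_in_iff by (fastforce simp: comp_def)
  obtain E e where D': "D' = E \<inter> N" "c' = fst \<circ> e" and E: "(E, e) \<in> maximal_atlas A"
    and slice: "e ` (E \<inter> N) = {z \<in> e ` E. snd z = 0}"
    using C' unfolding submanifold_atlas_def by blast
  have m: "(D, c) \<in> maximal_atlas A" using C atlas_subset_maximal by blast
  have ev: "\<forall>\<^sub>F x in nhds z. F x \<in> Q"
    by (rule smooth_param_eventually[OF F Q(1,2)])
  show ?thesis
  proof (rule smooth_paramI[OF E])
    show "\<forall>\<^sub>F x in nhds z. s (F x) \<in> E"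
      using ev by eventually_elim (use Q(4) D' in blast)
    have "smooth_at (\<lambda>x. c' (s (inv_into D c (c (F x))))) z"
      by (rule smooth_at_compose[OF findim smooth_param_atlas[OF F C]
            smooth_on_imp_smooth_at[OF sm_Q chart_neighbourhood_image[OF m Q(1,2,3)]]])
    then have "smooth_at (\<lambda>x. (c' (s (inv_into D c (c (F x)))), 0::'b)) z"
      by (rule smooth_at_Pair[OF _ smooth_at_const])
    then show "smooth_at (\<lambda>x. e (s (F x))) z"
    proof (rule smooth_at_cong)
      show "\<forall>\<^sub>F x in nhds z. (c' (s (inv_into D c (c (F x)))), 0) = e (s (F x))"
        using ev
      proof eventually_elim
        case (elim x)
        then have "inv_into D c (c (F x)) = F x" "s (F x) \<in> E \<inter> N"
          using chart_inv[OF m] Q D' by blast+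
        moreover from this have "snd (e (s (F x))) = 0"
          using slice by blast
        ultimately show ?case
          by (simp add: D' prod_eq_iff)
      qed
    qed
  qed
qed

section \<open>Maps of two variables, and parametrisations by open sets of a vector space\<close>

context smooth_manifold
begin

lemma open_in_prod_iff: "open_in (prod_atlas A A) Q \<longleftrightarrow> open Q"
proof -
  have "carrier_of (prod_atlas A A) = UNIV"
  proof -
    have "(x, y) \<in> carrier_of (prod_atlas A A)" for x y
    proof -
      obtain D c where C: "(D, c) \<in> A" "x \<in> D" by (rule chart_at)
      obtain D' c' where C': "(D', c') \<in> A" "y \<in> D'" by (rule chart_at)
      have "(D \<times> D', map_prod c c') \<in> prod_atlas A A"
        using C C' unfolding prod_atlas_def by blast
      then show ?thesis
        unfolding carrier_of_def by (rule UN_I) (use C C' in simp)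
    qed
    then show ?thesis by auto
  qed
  then show ?thesis by (simp add: open_in_def)
qed

text \<open>Serves for a local extension of the multiplication, which is smooth on an open set of
  pairs.\<close>

lemma smooth_param_binary_map:
  assumes sm: "smooth_map (prod_atlas A A) A W F"
    and F: "smooth_param A F1 z" "smooth_param A F2 z" and W: "(F1 z, F2 z) \<in> W"
  shows "smooth_param A (\<lambda>x. F (F1 x, F2 x)) z"
proof -
  obtain C0 D' c' Q where C0: "C0 \<in> prod_atlas A A" and C': "(D', c') \<in> A"
    and Q: "open Q" "(F1 z, F2 z) \<in> Q" "Q \<subseteq> fst C0" "F ` Q \<subseteq> D'"
    and sm_Q: "smooth_on (snd C0 ` Q) (\<lambda>x. c' (F (inv_into (fst C0) (snd C0) x)))"
    using sm W unfolding smooth_map_def open_in_prod_iff by (fastforce simp: comp_def)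
  obtain D1 c1 D2 c2 where "C0 = (D1 \<times> D2, map_prod c1 c2)"
    and C: "(D1, c1) \<in> A" "(D2, c2) \<in> A"
    using C0 unfolding prod_atlas_def by blast
  then have C0_eq: "fst C0 = D1 \<times> D2" "snd C0 = map_prod c1 c2" by auto
  have m: "(D1, c1) \<in> maximal_atlas A" "(D2, c2) \<in> maximal_atlas A"
    using C atlas_subset_maximal by blast+
  let ?c = "map_prod c1 c2" and ?i = "map_prod (inv_into D1 c1) (inv_into D2 c2)"
  have z: "F1 z \<in> D1" "F2 z \<in> D2"
    using Q(2,3) C0_eq by auto
  have "inj_on ?c (D1 \<times> D2)"
    by (rule inj_on_inverseI[where g = ?i]) (auto simp: chart_inv[OF m(1)] chart_inv[OF m(2)])
  then have inv: "inv_into (D1 \<times> D2) ?c (c1 x, c2 y) = (x, y)" if "x \<in> D1" "y \<in> D2" for x y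
    using inv_into_f_f[of ?c "D1 \<times> D2" "(x, y)"] that by simp
  have cont: "continuous_on (c1 ` D1 \<times> c2 ` D2) ?i"
    using chart_homeomorphism[OF m(1)] chart_homeomorphism[OF m(2)]
    unfolding homeomorphism_def map_prod_def case_prod_beta'
    by (intro continuous_on_Pair) (auto intro!: continuous_on_compose2[of _ _ _ fst] continuous_on_compose2[of _ _ _ snd] continuous_intros)
  \<comment> \<open>Writing the chart image of \<open>Q\<close> as a preimage under the continuous
    inverse \<open>?i\<close> shows that it is open.\<close>
  have "?c ` Q = (c1 ` D1 \<times> c2 ` D2) \<inter> ?i -` Q"
    using Q(3) chart_inv[OF m(1)] chart_inv[OF m(2)] unfolding C0_eq by force
  then have op: "open (?c ` Q)"
    using continuous_open_preimage[OF cont _ Q(1)] chart_open_image m by (simp add: open_Times)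
  have ev: "\<forall>\<^sub>F x in nhds z. (F1 x, F2 x) \<in> Q"
    by (rule topological_tendstoD[OF _ Q(1,2)]) (intro tendsto_Pair smooth_param_tendsto[OF F(1)] smooth_param_tendsto[OF F(2)])
  show ?thesis
  proof (rule smooth_paramI)
    show "(D', c') \<in> maximal_atlas A" using C' atlas_subset_maximal by blast
    show "\<forall>\<^sub>F x in nhds z. F (F1 x, F2 x) \<in> D'"
      using ev by eventually_elim (use Q(4) in blast)
    have "smooth_at (\<lambda>x. c' (F (inv_into (D1 \<times> D2) ?c (c1 (F1 x), c2 (F2 x))))) z"
    proof (rule smooth_at_compose[OF findim_prod[OF findim findim]])
      show "smooth_at (\<lambda>x. (c1 (F1 x), c2 (F2 x))) z"
        by (intro smooth_at_Pair smooth_param_atlas[OF F(1) C(1) z(1)] smooth_param_atlas[OF F(2) C(2) z(2)])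
      show "smooth_at (\<lambda>x. c' (F (inv_into (D1 \<times> D2) ?c x))) (c1 (F1 z), c2 (F2 z))"
        by (rule smooth_on_imp_smooth_at[OF _ op]) (use sm_Q C0_eq Q(2) in force)+
    qed
    then show "smooth_at (\<lambda>x. c' (F (F1 x, F2 x))) z"
    proof (rule smooth_at_cong)
      show "\<forall>\<^sub>F x in nhds z. c' (F (inv_into (D1 \<times> D2) ?c (c1 (F1 x), c2 (F2 x)))) = c' (F (F1 x, F2 x))"
        using ev by eventually_elim (use Q(3) C0_eq inv in force)
    qed
  qed
qed

context
  fixes W :: "'v::real_inner set" and \<psi> :: "'v \<Rightarrow> 'p"
  assumes diffeo: "diffeo_onto_open euclid A W \<psi>" and findim_W: "findim TYPE('v)"
begin

lemma diffeo_open: "open W" "open (\<psi> ` W)"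
  using diffeo unfolding diffeo_onto_open_def smooth_map_def open_in_euclid open_in_iff by blast+

lemma diffeo_inv: "z \<in> W \<Longrightarrow> inv_into W \<psi> (\<psi> z) = z"
  using diffeo unfolding diffeo_onto_open_def by simp

lemma diffeo_smooth_param: "z \<in> W \<Longrightarrow> smooth_param A \<psi> z"
  using diffeo smooth_map_imp_smooth_param unfolding diffeo_onto_open_def by blast

lemma diffeo_smooth_obs: "y \<in> \<psi> ` W \<Longrightarrow> smooth_obs A (inv_into W \<psi>) y"
  using diffeo smooth_map_imp_smooth_obs unfolding diffeo_onto_open_def by blast

lemma smooth_param_diffeo:
  fixes F :: "'u::real_normed_vector \<Rightarrow> 'v"
  assumes "smooth_at F z" "F z \<in> W"
  shows "smooth_param A (\<lambda>x. \<psi> (F x)) z"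
proof -
  obtain D c where C: "(D, c) \<in> A" "\<psi> (F z) \<in> D" by (rule chart_at)
  have m: "(D, c) \<in> maximal_atlas A" using C atlas_subset_maximal by blast
  note \<psi> = diffeo_smooth_param[OF assms(2)]
  show ?thesis
  proof (rule smooth_paramI[OF m])
    have "((\<lambda>x. \<psi> (F x)) \<longlongrightarrow> \<psi> (F z)) (nhds z)"
      by (rule filterlim_compose[OF smooth_param_tendsto[OF \<psi>] smooth_at_imp_tendsto[OF assms(1)]])
    then show "\<forall>\<^sub>F x in nhds z. \<psi> (F x) \<in> D"
      by (rule topological_tendstoD[OF _ chart_open_domain[OF m] C(2)])
    show "smooth_at (\<lambda>x. c (\<psi> (F x))) z"
      by (rule smooth_at_compose[OF findim_W assms(1) smooth_param_atlas[OF \<psi> C]])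
  qed
qed

lemma smooth_obs_diffeo:
  assumes "z \<in> W" "smooth_at (\<lambda>x. h (\<psi> x)) z"
  shows "smooth_obs A h (\<psi> z)"
proof (rule smooth_obs_cong)
  show "smooth_obs A (\<lambda>y. h (\<psi> (inv_into W \<psi> y))) (\<psi> z)"
    by (rule smooth_obs_compose[OF findim_W diffeo_smooth_obs]) (use assms diffeo_inv in auto)
  have "\<forall>\<^sub>F y in nhds (\<psi> z). y \<in> \<psi> ` W"
    using assms(1) diffeo_open by (intro eventually_nhds_in_open) auto
  then show "\<forall>\<^sub>F y in nhds (\<psi> z). h (\<psi> (inv_into W \<psi> y)) = h y"
    by eventually_elim (auto simp: diffeo_inv)
qed

text \<open>This replaces a germ \<open>h\<close> by the function \<open>h \<circ> \<psi>\<close> in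
  coordinates. From right to left, smoothness at \<open>z\<close> spreads to a neighbourhood of
  \<open>z\<close> and is carried to nearby points of the manifold by continuity of the inverse of
  \<open>\<psi>\<close>.\<close>

lemma smooth_germs_diffeo_iff:
  assumes z: "z \<in> W"
  shows "h \<in> smooth_germs A (\<psi> z) \<longleftrightarrow> smooth_at (\<lambda>x. h (\<psi> x)) z"
proof
  assume "h \<in> smooth_germs A (\<psi> z)"
  then show "smooth_at (\<lambda>x. h (\<psi> x)) z"
    by (intro smooth_at_obs_param[OF diffeo_smooth_param[OF z]] smooth_germs_imp_smooth_obs)
next
  assume sm: "smooth_at (\<lambda>x. h (\<psi> x)) z"
  have y: "\<psi> z \<in> \<psi> ` W" using z by blast
  have "\<forall>\<^sub>F x in nhds z. smooth_at (\<lambda>x. h (\<psi> x)) x"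
    by (rule eventually_smooth_at[OF sm])
  then have "\<forall>\<^sub>F y in nhds (\<psi> z). smooth_at (\<lambda>x. h (\<psi> x)) (inv_into W \<psi> y)"
    using smooth_obs_tendsto[OF diffeo_smooth_obs[OF y]] diffeo_inv[OF z]
    unfolding filterlim_iff by simp
  moreover have "\<forall>\<^sub>F y in nhds (\<psi> z). y \<in> \<psi> ` W"
    by (rule eventually_nhds_in_open[OF diffeo_open(2) y])
  ultimately have "\<forall>\<^sub>F y in nhds (\<psi> z). smooth_obs A h y"
    by eventually_elim (auto simp: diffeo_inv smooth_obs_diffeo)
  then show "h \<in> smooth_germs A (\<psi> z)"
    unfolding smooth_germs_iff .
qed

end

end

section \<open>Second-order differences\<close>

lemma DERIV_transform_eventually:
  "(f has_real_derivative d) (at x) \<Longrightarrow> \<forall>\<^sub>F t in nhds x. f t = g t \<Longrightarrow> (g has_real_derivative d) (at x)"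
  using DERIV_cong_ev[OF refl, of f g x d d] by simp

lemma smooth_at_chain_vector_derivative:
  assumes "smooth_at f (p t)" "(p has_vector_derivative v) (at t)"
  shows "((\<lambda>t. f (p t)) has_vector_derivative frechet_derivative f (at (p t)) v) (at t)"
proof -
  have D: "(f has_derivative frechet_derivative f (at (p t))) (at (p t))"
    by (rule smooth_at_imp_has_derivative[OF assms(1)])
  have "((\<lambda>t. f (p t)) has_derivative (\<lambda>x. frechet_derivative f (at (p t)) (x *\<^sub>R v))) (at t)"
    by (rule has_derivative_compose[of p, OF _ D]) (use assms(2) in \<open>simp add: has_vector_derivative_def\<close>)
  then show ?thesis
    unfolding has_vector_derivative_def using linear_scale[OF has_derivative_linear[OF D]] by simp
qed

lemma smooth_at_chain_DERIV:
  fixes f :: "'v::real_normed_vector \<Rightarrow> real"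
  assumes "smooth_at f (p t)" "(p has_vector_derivative v) (at t)"
  shows "((\<lambda>t. f (p t)) has_real_derivative frechet_derivative f (at (p t)) v) (at t)"
  using smooth_at_chain_vector_derivative[of f p t v] assms
  by (simp add: has_real_derivative_iff_has_vector_derivative)

text \<open>Two mean value steps, first in the second variable for k(s, .) - k(0, .), then in the
  first variable for \<open>kt\<close>, give s^2 times \<open>kst\<close> at a point of the square
  of side s. Continuity of \<open>kst\<close> at the origin finishes.\<close>

lemma mixed_difference_limit:
  fixes k :: "real \<times> real \<Rightarrow> real"
  assumes k: "smooth_at k (0, 0)"
  defines "kt \<equiv> \<lambda>p. frechet_derivative k (at p) (0, 1)"
  shows "((\<lambda>s. (k (s, s) - k (s, 0) - k (0, s) + k (0, 0)) / s\<^sup>2)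
           \<longlongrightarrow> frechet_derivative kt (at (0, 0)) (1, 0)) (at_right 0)"
proof (rule tendstoI)
  define kst where "kst p = frechet_derivative kt (at p) (1, 0)" for p
  have kt: "smooth_at kt (0, 0)"
    unfolding kt_def by (rule smooth_at_frechet_derivative[OF k])
  have "smooth_at kst (0, 0)"
    unfolding kst_def by (rule smooth_at_frechet_derivative[OF kt])
  fix e :: real assume "0 < e"
  then have "\<forall>\<^sub>F p in nhds (0, 0). dist (kst p) (kst (0, 0)) < e"
    by (rule tendstoD[OF smooth_at_imp_tendsto[OF \<open>smooth_at kst (0, 0)\<close>]])
  with eventually_smooth_at[OF k] eventually_smooth_at[OF kt]
  have "\<forall>\<^sub>F p in nhds (0, 0). smooth_at k p \<and> smooth_at kt p \<and> dist (kst p) (kst (0, 0)) < e"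
    by eventually_elim blast
  then obtain d where d: "d > 0" and near: "\<And>p. dist p (0, 0) < d \<Longrightarrow>
      smooth_at k p \<and> smooth_at kt p \<and> dist (kst p) (kst (0, 0)) < e"
    unfolding eventually_nhds_metric by blast
  \<comment> \<open>The distance of (a, b) from the origin is at most a + b, so squares of side
    below d / 2 lie in the ball of radius d.\<close>
  have good: "smooth_at k (a, b)" "smooth_at kt (a, b)" "dist (kst (a, b)) (kst (0, 0)) < e"
    if "0 \<le> a" "a \<le> s" "0 \<le> b" "b \<le> s" "s < d / 2" for a b s
  proof -
    have "dist (a, b) (0, 0) \<le> \<bar>a\<bar> + \<bar>b\<bar>"
      using norm_Pair_le[of a b] by (simp add: dist_norm zero_prod_def[symmetric])
    with that have "dist (a, b) (0, 0) < d" by linarith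
    then show "smooth_at k (a, b)" "smooth_at kt (a, b)" "dist (kst (a, b)) (kst (0, 0)) < e"
      using near by blast+
  qed
  have bound: "dist ((k (s, s) - k (s, 0) - k (0, s) + k (0, 0)) / s\<^sup>2) (kst (0, 0)) < e"
    if s: "0 < s" "s < d / 2" for s
  proof -
    have Dt: "((\<lambda>t. k (a, t)) has_real_derivative kt (a, t)) (at t)"
      if "a = 0 \<or> a = s" "0 \<le> t" "t \<le> s" for a t
      unfolding kt_def
      by (rule smooth_at_chain_DERIV)
        (use that s in \<open>auto intro!: good derivative_eq_intros simp: has_vector_derivative_def\<close>)
    have "\<exists>\<tau>>0. \<tau> < s \<and> (k (s, s) - k (0, s)) - (k (s, 0) - k (0, 0)) = (s - 0) * (kt (s, \<tau>) - kt (0, \<tau>))"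
      by (rule MVT2[OF s(1)]) (intro DERIV_diff Dt; simp)
    then obtain \<tau> where \<tau>: "0 < \<tau>" "\<tau> < s"
      "(k (s, s) - k (0, s)) - (k (s, 0) - k (0, 0)) = s * (kt (s, \<tau>) - kt (0, \<tau>))"
      by auto
    have "\<exists>\<xi>>0. \<xi> < s \<and> kt (s, \<tau>) - kt (0, \<tau>) = (s - 0) * kst (\<xi>, \<tau>)"
    proof (rule MVT2[OF s(1)])
      show "((\<lambda>a. kt (a, \<tau>)) has_real_derivative kst (a, \<tau>)) (at a)" if "0 \<le> a" "a \<le> s" for a
        unfolding kst_def
        by (rule smooth_at_chain_DERIV)
          (use that s \<tau> in \<open>auto intro!: good[where s = s] derivative_eq_intros simp: has_vector_derivative_def\<close>)
    qed
    then obtain \<xi> where \<xi>: "0 < \<xi>" "\<xi> < s" "kt (s, \<tau>) - kt (0, \<tau>) = s * kst (\<xi>, \<tau>)"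
      by auto
    have "k (s, s) - k (s, 0) - k (0, s) + k (0, 0) = s\<^sup>2 * kst (\<xi>, \<tau>)"
      using \<tau>(3) \<xi>(3) by (simp add: power2_eq_square)
    then show ?thesis
      using good(3)[of \<xi> s \<tau>] \<xi> \<tau> s by simp
  qed
  have "\<forall>\<^sub>F s in at_right 0. s < d / 2"
    using d by (intro eventually_at_rightI[of 0 "d / 2"]) auto
  then show "\<forall>\<^sub>F s in at_right 0.
      dist ((k (s, s) - k (s, 0) - k (0, s) + k (0, 0)) / s\<^sup>2) (frechet_derivative kt (at (0, 0)) (1, 0)) < e"
    using eventually_at_right_less[of 0]
    by eventually_elim (use bound in \<open>simp add: kst_def\<close>)
qed

text \<open>Both points move, and they may approach \<open>z\<close> much more slowly than each
  other; differentiability at \<open>z\<close> alone would not control the quotient. The mean value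
  theorem on the segment from \<open>b s\<close> to \<open>a s\<close> gives a derivative at a point
  tending to \<open>z\<close>, and the derivative is continuous.\<close>

lemma difference_quotient_limit:
  fixes H :: "'v::real_inner \<Rightarrow> real" and a b :: "'t \<Rightarrow> 'v"
  assumes fin: "findim TYPE('v)" and H: "smooth_at H z"
    and a: "(a \<longlongrightarrow> z) F" and b: "(b \<longlongrightarrow> z) F"
    and d: "((\<lambda>s. (a s - b s) /\<^sub>R c s) \<longlongrightarrow> d) F"
  shows "((\<lambda>s. (H (a s) - H (b s)) / c s) \<longlongrightarrow> frechet_derivative H (at z) d) F"
proof -
  obtain I :: "'v set" where I: "\<And>x. x = (\<Sum>b\<in>I. (x \<bullet> b) *\<^sub>R b)"
    using fin unfolding findim_def by blast
  \<comment> \<open>Continuity of the derivative is available for fixed directions, while the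
    direction here depends on s; hence its expansion in the finite set \<open>I\<close>.\<close>
  have expand: "frechet_derivative H (at y) x = (\<Sum>b\<in>I. (x \<bullet> b) * frechet_derivative H (at y) b)"
    if "smooth_at H y" for x y
  proof -
    have lin: "linear (frechet_derivative H (at y))"
      by (rule has_derivative_linear[OF smooth_at_imp_has_derivative[OF that]])
    have "frechet_derivative H (at y) x = frechet_derivative H (at y) (\<Sum>b\<in>I. (x \<bullet> b) *\<^sub>R b)"
      by (rule arg_cong[OF I])
    then show ?thesis by (simp add: linear_sum[OF lin] linear_scale[OF lin])
  qed
  obtain r where r: "r > 0" "\<And>y. y \<in> ball z r \<Longrightarrow> smooth_at H y"
    using eventually_smooth_at[OF H] unfolding eventually_nhds_metric by (auto simp: dist_commute)
  define seg where "seg s \<theta> = b s + \<theta> *\<^sub>R (a s - b s)" for s \<theta>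
  have seg_ball: "seg s \<theta> \<in> ball z e" if "0 \<le> \<theta>" "\<theta> \<le> 1" "a s \<in> ball z e" "b s \<in> ball z e" for s \<theta> e
  proof -
    have "seg s \<theta> = (1 - \<theta>) *\<^sub>R b s + \<theta> *\<^sub>R a s"
      unfolding seg_def by (simp add: algebra_simps)
    then show ?thesis
      using convexD_alt[OF convex_ball that(4,3,1,2)] by simp
  qed
  \<comment> \<open>With the ball condition inside the existential a parameter exists for every s,
    so that it can be chosen as a function of s.\<close>
  have "\<exists>\<theta>. 0 \<le> \<theta> \<and> \<theta> \<le> 1 \<and> (a s \<in> ball z r \<and> b s \<in> ball z r \<longrightarrow>
      H (a s) - H (b s) = frechet_derivative H (at (seg s \<theta>)) (a s - b s))" for s
  proof (cases "a s \<in> ball z r \<and> b s \<in> ball z r")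
    case True
    have "\<exists>\<theta>>0. \<theta> < 1 \<and> H (seg s 1) - H (seg s 0) =
        (1 - 0) * frechet_derivative H (at (seg s \<theta>)) (a s - b s)"
    proof (rule MVT2[OF zero_less_one])
      show "((\<lambda>\<theta>. H (seg s \<theta>)) has_real_derivative
          frechet_derivative H (at (seg s \<theta>)) (a s - b s)) (at \<theta>)" if "0 \<le> \<theta>" "\<theta> \<le> 1" for \<theta>
      proof (rule smooth_at_chain_DERIV)
        show "smooth_at H (seg s \<theta>)" using r(2) seg_ball that True by blast
        show "(seg s has_vector_derivative a s - b s) (at \<theta>)"
          unfolding seg_def has_vector_derivative_def by (auto intro!: derivative_eq_intros)
      qed
    qed
    then obtain \<theta> where "\<theta> > 0" "\<theta> < 1" "H (seg s 1) - H (seg s 0) =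
        (1 - 0) * frechet_derivative H (at (seg s \<theta>)) (a s - b s)" by blast
    then show ?thesis by (intro exI[of _ \<theta>]) (simp add: seg_def)
  qed auto
  then obtain \<theta> where \<theta>: "\<And>s. 0 \<le> \<theta> s" "\<And>s. \<theta> s \<le> 1"
    and MVT: "\<And>s. a s \<in> ball z r \<Longrightarrow> b s \<in> ball z r \<Longrightarrow>
      H (a s) - H (b s) = frechet_derivative H (at (seg s (\<theta> s))) (a s - b s)"
    by metis
  have near: "\<forall>\<^sub>F s in F. a s \<in> ball z e \<and> b s \<in> ball z e" if "e > 0" for e
    using tendstoD[OF a that] tendstoD[OF b that] by eventually_elim (simp add: dist_commute)
  have "((\<lambda>s. seg s (\<theta> s)) \<longlongrightarrow> z) F"
  proof (rule tendstoI)
    fix e :: real assume "e > 0"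
    from near[OF this] show "\<forall>\<^sub>F s in F. dist (seg s (\<theta> s)) z < e"
      by eventually_elim (use seg_ball[OF \<theta>] in \<open>auto simp: dist_commute\<close>)
  qed
  then have "((\<lambda>s. frechet_derivative H (at (seg s (\<theta> s))) v) \<longlongrightarrow> frechet_derivative H (at z) v) F" for v
    by (rule filterlim_compose[OF smooth_at_imp_tendsto[OF smooth_at_frechet_derivative[OF H]]])
  then have "((\<lambda>s. \<Sum>v\<in>I. (((a s - b s) /\<^sub>R c s) \<bullet> v) * frechet_derivative H (at (seg s (\<theta> s))) v)
      \<longlongrightarrow> (\<Sum>v\<in>I. (d \<bullet> v) * frechet_derivative H (at z) v)) F"
    by (intro tendsto_sum tendsto_mult tendsto_inner d tendsto_const)
  moreover have "\<forall>\<^sub>F s in F. (\<Sum>v\<in>I. (((a s - b s) /\<^sub>R c s) \<bullet> v) * frechet_derivative H (at (seg s (\<theta> s))) v)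
      = (H (a s) - H (b s)) / c s"
    using near[OF r(1)]
  proof eventually_elim
    case (elim s)
    then have "smooth_at H (seg s (\<theta> s))"
      using r(2) seg_ball[OF \<theta>] by blast
    then show ?case
      using elim MVT[of s] expand[of "seg s (\<theta> s)" "a s - b s"]
      by (simp add: sum_divide_distrib divide_inverse sum_distrib_left mult_ac)
  qed
  ultimately show ?thesis
    using expand[OF H, of d] filterlim_cong[OF refl refl] by fastforce
qed

section \<open>Groupoids in adapted charts\<close>

context
  fixes G :: "('g, 'e) groupoid_manifold"
  assumes G: "groupoid G"
begin

lemma composable_iff: "(g, h) \<in> composable G \<longleftrightarrow> src G g = rng G h"
  by (simp add: composable_def)

lemma src_ginv: "src G (ginv G g) = rng G g" and rng_ginv: "rng G (ginv G g) = src G g"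
  using G unfolding groupoid_def by (simp_all add: composable_iff src_def rng_def)

lemma gmul_composable:
  assumes "src G g = rng G h" "src G h = rng G k"
  shows "src G (gmul G g h) = rng G k" "src G g = rng G (gmul G h k)"
  using G assms unfolding groupoid_def composable_iff by blast+

text \<open>Composability of partial products in the chains g, g^-1, g and g^-1, g, g^-1 gives two
  of the four identities each.\<close>

lemma rng_rng: "rng G (rng G g) = rng G g" and src_rng: "src G (rng G g) = rng G g"
  and rng_src: "rng G (src G g) = src G g" and src_src: "src G (src G g) = src G g"
  using gmul_composable[of g "ginv G g" g] gmul_composable[of "ginv G g" g "ginv G g"]
  by (simp_all add: src_ginv rng_ginv src_def[of G g] rng_def[of G g])

lemma gmul_rng: "gmul G (rng G g) g = g"
  using G src_ginv rng_ginv unfolding groupoid_def composable_iff rng_def by metis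

lemma gmul_src: "gmul G g (src G g) = g"
  using G src_ginv rng_ginv unfolding groupoid_def composable_iff src_def by metis

text \<open>In the chain r(g), g, h the pair (r(g), gh) is composable, so r(gh) is the source of
  r(g).\<close>

lemma rng_gmul: "src G g = rng G h \<Longrightarrow> rng G (gmul G g h) = rng G g"
  using gmul_composable(2)[of "rng G g" g h] src_rng by simp

lemma src_in_units: "src G g \<in> units G"
  unfolding units_def using rng_ginv by (metis rangeI)

lemma rng_unit: "x \<in> units G \<Longrightarrow> rng G x = x" and src_unit: "x \<in> units G \<Longrightarrow> src G x = x"
  unfolding units_def using rng_rng src_rng by auto

end

section \<open>The source map and the product in adapted charts\<close>

locale adapted_lie_groupoid =
  fixes G :: "('g::{t2_space, second_countable_topology},
               'a::real_inner \<times> 'b::real_inner) groupoid_manifold"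
    and U :: "'a set" and V :: "'b set" and \<psi> :: "'a \<times> 'b \<Rightarrow> 'g" and \<phi> :: "'a \<Rightarrow> 'g" and x0 :: 'g
  assumes lie: "lie_groupoid G"
    and charts: "adapted_charts G U V \<psi> \<phi> x0"
    and findim_a: "findim TYPE('a)" and findim_b: "findim TYPE('b)"
begin

lemma groupoid: "groupoid G"
  using lie unfolding lie_groupoid_def by blast

lemma findim_ab: "findim TYPE('a \<times> 'b)"
  by (rule findim_prod[OF findim_a findim_b])

sublocale smooth_manifold "gatlas G"
  using lie findim_ab unfolding lie_groupoid_def by unfold_locales auto

abbreviation \<psi>inv :: "'g \<Rightarrow> 'a \<times> 'b" where "\<psi>inv \<equiv> inv_into (U \<times> V) \<psi>"

abbreviation \<sigma> :: "'a \<times> 'b \<Rightarrow> 'a" where "\<sigma> z \<equiv> sigma_map G U \<psi> \<phi> (fst z) (snd z)"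

text \<open>The source map read in the chart \<open>\<psi>\<close>, which equals
  (\<open>\<sigma>\<close>, 0) near the zero section. Smoothness is shown for \<open>S\<close>,
  because the inverse of \<open>\<psi>\<close> is smooth on the groupoid whereas that of
  \<open>\<phi>\<close> is given as smooth on the unit space.\<close>

abbreviation S :: "'a \<times> 'b \<Rightarrow> 'a \<times> 'b" where "S z \<equiv> \<psi>inv (src G (\<psi> z))"

text \<open>\<open>\<Theta>\<close> expresses a local smooth extension of the multiplication in
  coordinates. Off the composable pairs its values are arbitrary, hence the implication.\<close>

definition product_in_chart :: "(('a \<times> 'b) \<times> ('a \<times> 'b) \<Rightarrow> 'a \<times> 'b) \<Rightarrow> ('a \<times> 'b) \<times> ('a \<times> 'b) \<Rightarrow> bool" where
  "product_in_chart \<Theta> p \<longleftrightarrow> \<Theta> p \<in> U \<times> V \<and> fst p \<in> U \<times> V \<and> snd p \<in> U \<times> V \<and>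
     (src G (\<psi> (fst p)) = rng G (\<psi> (snd p)) \<longrightarrow> gmul G (\<psi> (fst p)) (\<psi> (snd p)) = \<psi> (\<Theta> p))"

definition vertical_section :: "'b \<Rightarrow> 'g \<Rightarrow> 'g tangent" where
  "vertical_section w x = velocity (gatlas G) (\<lambda>t. \<psi> (inv_into U \<phi> x, t *\<^sub>R w))"

lemma diffeo_\<psi>: "diffeo_onto_open euclid (gatlas G) (U \<times> V) \<psi>"
  and open_U: "open U" and open_V: "open V" and zero_V: "0 \<in> V"
  and rng_\<psi>: "z \<in> U \<times> V \<Longrightarrow> rng G (\<psi> z) = \<phi> (fst z)"
  and slice_\<psi>: "\<psi> ` (U \<times> {0}) = \<psi> ` (U \<times> V) \<inter> units G"
  using charts unfolding adapted_charts_def by auto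

lemma \<psi>inv_\<psi>: "z \<in> U \<times> V \<Longrightarrow> \<psi>inv (\<psi> z) = z"
  by (rule diffeo_inv[OF diffeo_\<psi> findim_ab])

lemma inj_\<phi>: "inj_on \<phi> U"
  using charts unfolding adapted_charts_def diffeo_onto_open_def by blast

lemma \<psi>_zero_unit: "u \<in> U \<Longrightarrow> \<psi> (u, 0) \<in> units G"
  using slice_\<psi> by blast

text \<open>\<open>\<psi> (u, 0)\<close> is a unit, hence its own range, and the range of
  \<open>\<psi> (u, v)\<close> is \<open>\<phi> u\<close>.\<close>

lemma \<phi>_eq: "u \<in> U \<Longrightarrow> \<psi> (u, 0) = \<phi> u"
  using rng_unit[OF groupoid \<psi>_zero_unit] rng_\<psi>[of "(u, 0)"] zero_V by simp

lemma \<phi>_unit: "u \<in> U \<Longrightarrow> rng G (\<phi> u) = \<phi> u" "u \<in> U \<Longrightarrow> src G (\<phi> u) = \<phi> u"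
  using \<psi>_zero_unit \<phi>_eq rng_unit[OF groupoid] src_unit[OF groupoid] by metis+

lemma unit_in_chart:
  assumes "y \<in> units G" "y \<in> \<psi> ` (U \<times> V)"
  shows "inv_into U \<phi> y \<in> U" "\<phi> (inv_into U \<phi> y) = y" "\<psi>inv y = (inv_into U \<phi> y, 0)"
proof -
  have "y \<in> \<psi> ` (U \<times> {0})"
    using slice_\<psi> assms by blast
  then obtain u where u: "u \<in> U" "y = \<phi> u"
    using \<phi>_eq by auto
  then show "inv_into U \<phi> y \<in> U" "\<phi> (inv_into U \<phi> y) = y" "\<psi>inv y = (inv_into U \<phi> y, 0)"
    using \<psi>inv_\<psi>[of "(u, 0)"] zero_V \<phi>_eq inj_\<phi> by auto
qed

lemma source_in_chart:
  assumes "src G (\<psi> z) \<in> \<psi> ` (U \<times> V)"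
  shows "\<sigma> z \<in> U" "\<phi> (\<sigma> z) = src G (\<psi> z)" "S z = (\<sigma> z, 0)"
  using unit_in_chart[OF src_in_units[OF groupoid] assms] by (simp_all add: sigma_map_def)

lemma smooth_at_\<psi>inv:
  assumes "smooth_param (gatlas G) F z" "F z \<in> \<psi> ` (U \<times> V)"
  shows "smooth_at (\<lambda>x. \<psi>inv (F x)) z"
  by (rule smooth_at_obs_param[OF assms(1) diffeo_smooth_obs[OF diffeo_\<psi> findim_ab assms(2)]])

lemma smooth_param_\<psi>:
  "smooth_at F z \<Longrightarrow> F z \<in> U \<times> V \<Longrightarrow> smooth_param (gatlas G) (\<lambda>x. \<psi> (F x)) z"
  by (rule smooth_param_diffeo[OF diffeo_\<psi> findim_ab])

lemma smooth_germs_\<psi>_iff: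
  "z \<in> U \<times> V \<Longrightarrow> h \<in> smooth_germs (gatlas G) (\<psi> z) \<longleftrightarrow> smooth_at (\<lambda>x. h (\<psi> x)) z"
  by (rule smooth_germs_diffeo_iff[OF diffeo_\<psi> findim_ab])

lemma eventually_in_chart: "z \<in> U \<times> V \<Longrightarrow> \<forall>\<^sub>F x in nhds z. x \<in> U \<times> V"
  using open_U open_V by (intro eventually_nhds_in_open open_Times)

lemma eventually_in_chart_image:
  "smooth_param (gatlas G) F z \<Longrightarrow> F z \<in> \<psi> ` (U \<times> V) \<Longrightarrow> \<forall>\<^sub>F x in nhds z. F x \<in> \<psi> ` (U \<times> V)"
  by (rule smooth_param_eventually[OF _ diffeo_open(2)[OF diffeo_\<psi> findim_ab]])

lemma zero_section_in_chart: "u \<in> U \<Longrightarrow> (u, 0) \<in> U \<times> V"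
  using zero_V by simp

lemma smooth_param_source:
  assumes "z \<in> U \<times> V"
  shows "smooth_param (gatlas G) (\<lambda>x. src G (\<psi> x)) z"
proof (rule smooth_param_submanifold_map[where s = "src G" and F = \<psi> and W = UNIV])
  show "smooth_manifold (gatlas G)" by (rule smooth_manifold_axioms)
  show "smooth_map (gatlas G) (submanifold_atlas (gatlas G) (units G)) UNIV (src G)"
    using lie carrier unfolding lie_groupoid_def submersion_def unit_atlas_def by simp
  show "smooth_param (gatlas G) \<psi> z"
    using diffeo_smooth_param[OF diffeo_\<psi> findim_ab assms] .
qed simp

context
  fixes u assumes u: "u \<in> U"
begin

lemma source_zero: "src G (\<psi> (u, 0)) = \<psi> (u, 0)" "\<sigma> (u, 0) = u" "S (u, 0) = (u, 0)"
  using u \<phi>_eq \<phi>_unit \<psi>inv_\<psi>[of "(u, 0)"] zero_V inj_\<phi> by (auto simp: sigma_map_def)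

lemma smooth_at_S: "smooth_at S (u, 0)"
  by (rule smooth_at_\<psi>inv[OF smooth_param_source[OF zero_section_in_chart[OF u]]])
    (use source_zero u zero_V in auto)

lemma eventually_source_in_chart: "\<forall>\<^sub>F z in nhds (u, 0). src G (\<psi> z) \<in> \<psi> ` (U \<times> V)"
  by (rule eventually_in_chart_image[OF smooth_param_source[OF zero_section_in_chart[OF u]]])
    (use source_zero u zero_V in auto)

text \<open>Near the composable pair (x, x), with x the unit \<open>\<psi> (u, 0)\<close>,
  multiplication extends to a smooth map \<open>F\<close>. As xx = x lies in the chart image, so do
  nearby values of \<open>F\<close>, which can be read in coordinates.\<close>

lemma local_product:
  obtains \<Theta> where "smooth_at \<Theta> ((u, 0), (u, 0))"
    "\<forall>\<^sub>F p in nhds ((u, 0), (u, 0)). product_in_chart \<Theta> p"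
proof -
  let ?x = "\<psi> (u, 0)" and ?p = "((u, 0::'b), (u, 0::'b))"
  have z: "(u, 0) \<in> U \<times> V" using u zero_V by simp
  have "(?x, ?x) \<in> composable G"
    using \<phi>_unit \<phi>_eq u by (simp add: composable_iff[OF groupoid])
  then obtain W F where W: "(?x, ?x) \<in> W"
    and F: "smooth_map (prod_atlas (gatlas G) (gatlas G)) (gatlas G) W F"
    and F_eq: "\<And>g h. (g, h) \<in> W \<Longrightarrow> (g, h) \<in> composable G \<Longrightarrow> F (g, h) = gmul G g h"
    using lie unfolding lie_groupoid_def smooth_map_on_subset_def by fastforce
  have P: "smooth_param (gatlas G) (\<lambda>p. \<psi> (fst p)) ?p" "smooth_param (gatlas G) (\<lambda>p. \<psi> (snd p)) ?p"
    by (rule smooth_param_\<psi>; use z smooth_at_fst[OF smooth_at_ident] smooth_at_snd[OF smooth_at_ident] in auto)+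
  have FP: "smooth_param (gatlas G) (\<lambda>p. F (\<psi> (fst p), \<psi> (snd p))) ?p"
    by (rule smooth_param_binary_map[OF F P]) (use W in simp)
  have Fx: "F (\<psi> (fst ?p), \<psi> (snd ?p)) \<in> \<psi> ` (U \<times> V)"
    using F_eq[OF W \<open>(?x, ?x) \<in> composable G\<close>] gmul_rng[OF groupoid, of ?x] \<phi>_eq[OF u] \<phi>_unit[OF u]
      imageI[OF z, of \<psi>] by simp
  define \<Theta> where "\<Theta> p = \<psi>inv (F (\<psi> (fst p), \<psi> (snd p)))" for p
  have "open W"
    using F open_in_prod_iff unfolding smooth_map_def by blast
  then have "\<forall>\<^sub>F p in nhds ?p. (\<psi> (fst p), \<psi> (snd p)) \<in> W"
    by (intro topological_tendstoD[OF tendsto_Pair[OF smooth_param_tendsto[OF P(1)] smooth_param_tendsto[OF P(2)]]])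
      (use W in auto)
  moreover have "\<forall>\<^sub>F p in nhds ?p. p \<in> (U \<times> V) \<times> (U \<times> V)"
    using open_U open_V z by (intro eventually_nhds_in_open open_Times) auto
  ultimately have "\<forall>\<^sub>F p in nhds ?p. product_in_chart \<Theta> p"
    using eventually_in_chart_image[OF FP Fx]
  proof eventually_elim
    case (elim p)
    then show ?case
      using F_eq by (auto simp: product_in_chart_def \<Theta>_def composable_iff[OF groupoid] inv_into_into f_inv_into_f)
  qed
  moreover have "smooth_at \<Theta> ?p"
    unfolding \<Theta>_def by (rule smooth_at_\<psi>inv[OF FP Fx])
  ultimately show ?thesis by (rule that[rotated])
qed

end

end

section \<open>Left translation in coordinates\<close>

context adapted_lie_groupoid
begin

lemma smooth_at_vertical_line: "smooth_at (\<lambda>t. (a, t *\<^sub>R w)) t0"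
  by (intro smooth_at_Pair smooth_at_const smooth_at_scaleR smooth_at_ident)

lemma eventually_vertical_line:
  assumes "a \<in> U"
  shows "\<forall>\<^sub>F t in nhds 0. (a, t *\<^sub>R w) \<in> U \<times> V"
  by (rule topological_tendstoD[OF smooth_at_imp_tendsto[OF smooth_at_vertical_line]])
    (use open_U open_V zero_V assms in \<open>auto intro: open_Times\<close>)

lemma smooth_param_vertical_line:
  assumes "a \<in> U"
  shows "smooth_param (gatlas G) (\<lambda>t. \<psi> (a, t *\<^sub>R w)) 0"
  by (rule smooth_param_\<psi>[OF smooth_at_vertical_line]) (use assms zero_V in simp)

text \<open>The derivative of left translation follows a curve picked by \<open>SOME\<close>. The
  explicit curve \<open>\<gamma>0\<close> is admissible, so the picked one is too and has the same
  velocity. Both translated curves are then differentiated by applying this velocity to one germ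
  \<open>k\<close>.\<close>

lemma left_invariant_extension_in_chart:
  assumes z: "z \<in> U \<times> V" "src G (\<psi> z) \<in> \<psi> ` (U \<times> V)"
    and \<Theta>: "smooth_at \<Theta> (z, S z)" "\<forall>\<^sub>F p in nhds (z, S z). product_in_chart \<Theta> p"
    and h: "h \<in> smooth_germs (gatlas G) (\<psi> z)"
  shows "((\<lambda>t. h (\<psi> (\<Theta> (z, (\<sigma> z, t *\<^sub>R w))))) has_real_derivative
           left_invariant_extension G (vertical_section w) (\<psi> z) h) (at 0)"
proof -
  note src = source_in_chart[OF z(2)]
  let ?y = "\<psi> z"
  define \<gamma>0 where "\<gamma>0 t = \<psi> (\<sigma> z, t *\<^sub>R w)" for t
  have \<psi>S: "\<psi> (S z) = src G ?y" by (rule f_inv_into_f[OF z(2)])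
  have Sz: "S z \<in> U \<times> V" by (rule inv_into_into[OF z(2)])
  have \<gamma>0: "smooth_param (gatlas G) \<gamma>0 0" "\<gamma>0 0 = src G ?y"
    unfolding \<gamma>0_def using smooth_param_vertical_line[OF src(1)] \<psi>S src(3) by simp_all
  have section_eq: "vertical_section w (src G ?y) = velocity (gatlas G) \<gamma>0"
    unfolding vertical_section_def \<gamma>0_def using src inv_into_f_f[OF inj_\<phi> src(1)] by simp
  define is_curve where "is_curve \<gamma> \<longleftrightarrow>
    (\<exists>\<delta>>0. smooth_map euclid (gatlas G) {-\<delta><..<\<delta>} \<gamma> \<and> (\<forall>t\<in>{-\<delta><..<\<delta>}. rng G (\<gamma> t) = src G ?y)) \<and>
    \<gamma> 0 = src G ?y \<and> velocity (gatlas G) \<gamma> = vertical_section w (src G ?y)" for \<gamma>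
  have "is_curve \<gamma>0"
  proof -
    obtain \<delta> where \<delta>: "\<delta> > 0" "\<And>t. dist t 0 < \<delta> \<Longrightarrow> (\<sigma> z, t *\<^sub>R w) \<in> U \<times> V"
      using eventually_vertical_line[OF src(1), of w] unfolding eventually_nhds_metric by blast
    have in_chart: "(\<sigma> z, t *\<^sub>R w) \<in> U \<times> V" if "t \<in> {-\<delta><..<\<delta>}" for t
      by (rule \<delta>(2)) (use that in \<open>simp add: dist_real_def abs_less_iff\<close>)
    have "smooth_map euclid (gatlas G) {-\<delta><..<\<delta>} \<gamma>0"
      unfolding \<gamma>0_def
      by (rule smooth_param_imp_smooth_map) (auto intro!: smooth_param_\<psi> smooth_at_vertical_line in_chart)
    moreover have "rng G (\<gamma>0 t) = src G ?y" if "t \<in> {-\<delta><..<\<delta>}" for t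
      unfolding \<gamma>0_def using rng_\<psi>[OF in_chart[OF that]] src(2) by simp
    ultimately show ?thesis
      unfolding is_curve_def using \<delta>(1) \<gamma>0(2) section_eq[symmetric] by blast
  qed
  define \<gamma> where "\<gamma> = (SOME \<gamma>. is_curve \<gamma>)"
  have "is_curve \<gamma>" unfolding \<gamma>_def using \<open>is_curve \<gamma>0\<close> by (rule someI[of is_curve])
  then obtain \<delta> where \<delta>: "\<delta> > 0" "smooth_map euclid (gatlas G) {-\<delta><..<\<delta>} \<gamma>"
      "\<And>t. t \<in> {-\<delta><..<\<delta>} \<Longrightarrow> rng G (\<gamma> t) = src G ?y"
    and \<gamma>_0: "\<gamma> 0 = src G ?y" and \<gamma>_velocity: "velocity (gatlas G) \<gamma> = velocity (gatlas G) \<gamma>0"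
    unfolding is_curve_def section_eq by blast
  have \<gamma>: "smooth_param (gatlas G) \<gamma> 0"
    by (rule smooth_map_imp_smooth_param[OF \<delta>(2)]) (use \<delta>(1) in simp)
  have ext: "left_invariant_extension G (vertical_section w) ?y h = velocity (gatlas G) (\<lambda>t. gmul G ?y (\<gamma> t)) h"
    unfolding left_invariant_extension_def left_translation_derivative_def Let_def \<gamma>_def is_curve_def ..
  have gmul_0: "gmul G ?y (\<gamma> 0) = ?y"
    by (simp add: \<gamma>_0 gmul_src[OF groupoid])
  text \<open>The germ \<open>k\<close> at \<open>s(y)\<close> agrees with \<open>h \<circ> L\<^sub>y\<close> on the \<open>r\<close>-fibre of \<open>s(y)\<close>; hence the derivative
    of \<open>h \<circ> L\<^sub>y\<close> along a curve in this fibre depends on the velocity only.\<close>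
  define k where "k y' = h (\<psi> (\<Theta> (z, \<psi>inv y')))" for y'
  \<comment> \<open>Multiplying by s(y) on the right fixes y. Thus the composite below evaluates
    \<open>h\<close> at y, where it is a germ.\<close>
  have "\<Theta> (z, S z) = z"
  proof -
    have "product_in_chart \<Theta> (z, S z)"
      by (rule eventually_nhds_x_imp_x[OF \<Theta>(2)])
    then have "\<psi> (\<Theta> (z, S z)) = \<psi> z" "\<Theta> (z, S z) \<in> U \<times> V"
      unfolding product_in_chart_def using \<psi>S rng_src[OF groupoid] gmul_src[OF groupoid] by auto
    then show ?thesis using \<psi>inv_\<psi> z(1) by metis
  qed
  have "smooth_at (\<lambda>z'. h (\<psi> (\<Theta> (z, z')))) (S z)"
  proof (rule smooth_at_compose[OF findim_ab])
    show "smooth_at (\<lambda>z'. \<Theta> (z, z')) (S z)"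
      by (rule smooth_at_compose[OF findim_prod[OF findim_ab findim_ab]])
        (intro smooth_at_Pair smooth_at_const smooth_at_ident \<Theta>)+
    show "smooth_at (\<lambda>z. h (\<psi> z)) (\<Theta> (z, S z))"
      using h smooth_germs_\<psi>_iff[OF z(1)] \<open>\<Theta> (z, S z) = z\<close> by simp
  qed
  then have "smooth_at (\<lambda>z'. k (\<psi> z')) (S z)"
  proof (rule smooth_at_cong)
    show "\<forall>\<^sub>F z' in nhds (S z). h (\<psi> (\<Theta> (z, z'))) = k (\<psi> z')"
      using eventually_in_chart[OF Sz] by eventually_elim (simp add: k_def \<psi>inv_\<psi>)
  qed
  then have k: "k \<in> smooth_germs (gatlas G) (src G ?y)"
    using smooth_germs_\<psi>_iff[OF Sz] \<psi>S by simp
  have "\<forall>\<^sub>F z' in nhds (S z). product_in_chart \<Theta> (z, z')"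
    by (rule eventually_compose_filterlim[OF \<Theta>(2)])
      (rule smooth_at_imp_tendsto[OF smooth_at_Pair[OF smooth_at_const smooth_at_ident]])
  then have "\<forall>\<^sub>F y' in nhds (src G ?y). product_in_chart \<Theta> (z, \<psi>inv y')"
    by (rule eventually_compose_filterlim)
      (rule smooth_obs_tendsto[OF diffeo_smooth_obs[OF diffeo_\<psi> findim_ab z(2)]])
  then have "\<forall>\<^sub>F t in nhds 0. product_in_chart \<Theta> (z, \<psi>inv (\<gamma> t))"
    by (rule eventually_compose_filterlim) (use smooth_param_tendsto[OF \<gamma>] \<gamma>_0 in simp)
  moreover have "\<forall>\<^sub>F t in nhds 0. t \<in> {-\<delta><..<\<delta>}"
    using \<delta>(1) by (intro eventually_nhds_in_open) auto
  moreover have "\<forall>\<^sub>F t in nhds 0. \<gamma> t \<in> \<psi> ` (U \<times> V)"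
    by (rule eventually_in_chart_image[OF \<gamma>]) (use \<gamma>_0 z in simp)
  \<comment> \<open>Since \<open>\<gamma>\<close> runs in the r-fibre of s(y), each pair is
    composable, and there \<open>\<Theta>\<close> is the true product.\<close>
  ultimately have "\<forall>\<^sub>F t in nhds 0. h (gmul G ?y (\<gamma> t)) = k (\<gamma> t)"
    by eventually_elim (use \<delta>(3) in \<open>auto simp: k_def product_in_chart_def f_inv_into_f\<close>)
  then have "\<forall>\<^sub>F t in nhds 0. k (\<gamma> t) = h (gmul G ?y (\<gamma> t))"
    by eventually_elim simp
  then have "((\<lambda>t. h (gmul G ?y (\<gamma> t))) has_real_derivative velocity (gatlas G) \<gamma> k) (at 0)"
    by (rule DERIV_transform_eventually[rotated]) (use DERIV_germ_param[OF \<gamma>, of k] k \<gamma>_0 in simp)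
  then have "left_invariant_extension G (vertical_section w) ?y h = velocity (gatlas G) \<gamma>0 k"
    unfolding ext \<gamma>_velocity by (intro velocity_eqI) (use h gmul_0 in simp_all)
  moreover have "((\<lambda>t. k (\<gamma>0 t)) has_real_derivative velocity (gatlas G) \<gamma>0 k) (at 0)"
    by (rule DERIV_germ_param[OF \<gamma>0(1)]) (use k \<gamma>0(2) in simp)
  moreover have "\<forall>\<^sub>F t in nhds 0. k (\<gamma>0 t) = h (\<psi> (\<Theta> (z, (\<sigma> z, t *\<^sub>R w))))"
    using eventually_vertical_line[OF src(1), of w]
    by eventually_elim (simp add: k_def \<gamma>0_def \<psi>inv_\<psi>)
  ultimately show ?thesis
    using DERIV_transform_eventually by simp
qed

end

text \<open>Along the ray (s v, s w) the bilinear term is s^2 B(v, w) and the remainder is O(s^3),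
  so O(s) is left after division. The condition \<open>(v, w) \<noteq> (0, 0)\<close> keeps the ray
  off the origin, which the filter of the expansion excludes.\<close>

lemma product_expansion_limit:
  assumes exp: "product_expansion G U V \<psi> \<phi> B" and u: "u \<in> U" and nz: "(v, w) \<noteq> (0, 0)"
  shows "((\<lambda>s. (product_map G U V \<psi> \<phi> u (s *\<^sub>R v) (s *\<^sub>R w) - (s *\<^sub>R v + s *\<^sub>R w)) /\<^sub>R s\<^sup>2) \<longlongrightarrow> B u v w) (at_right 0)"
proof -
  let ?p = "\<lambda>s. product_map G U V \<psi> \<phi> u (s *\<^sub>R v) (s *\<^sub>R w)"
  have bil: "bilinear (B u)"
    using exp u unfolding product_expansion_def by blast
  obtain C where C: "\<forall>\<^sub>F p in at (0, 0). norm (norm (product_map G U V \<psi> \<phi> u (fst p) (snd p) - (fst p + snd p + B u (fst p) (snd p))))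
      \<le> C * norm (norm (fst p, snd p) ^ 3)"
    using exp u unfolding product_expansion_def bigo_def by (auto simp: case_prod_beta')
  have lim: "filterlim (\<lambda>s. (s *\<^sub>R v, s *\<^sub>R w)) (at (0, 0)) (at_right 0)"
  proof (rule filterlim_atI)
    have "((\<lambda>s. (s *\<^sub>R v, s *\<^sub>R w)) \<longlongrightarrow> (0 *\<^sub>R v, 0 *\<^sub>R w)) (at_right 0)"
      by (intro tendsto_intros)
    then show "((\<lambda>s. (s *\<^sub>R v, s *\<^sub>R w)) \<longlongrightarrow> (0, 0)) (at_right 0)" by simp
    show "\<forall>\<^sub>F s in at_right 0. (s *\<^sub>R v, s *\<^sub>R w) \<noteq> (0, 0)"
      using eventually_at_right_less[of "0::real"] by eventually_elim (use nz in auto)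
  qed
  have "\<forall>\<^sub>F s in at_right 0. norm ((?p s - (s *\<^sub>R v + s *\<^sub>R w)) /\<^sub>R s\<^sup>2 - B u v w) \<le> C * norm (v, w) ^ 3 * s"
    using eventually_compose_filterlim[OF C lim] eventually_at_right_less[of 0]
  proof eventually_elim
    case (elim s)
    have B: "B u (s *\<^sub>R v) (s *\<^sub>R w) = s\<^sup>2 *\<^sub>R B u v w"
      using bil by (simp add: bilinear_lmul bilinear_rmul power2_eq_square)
    have "norm (s *\<^sub>R v, s *\<^sub>R w) = s * norm (v, w)"
      using norm_scaleR[of s "(v, w)"] elim by simp
    then have le: "norm (?p s - (s *\<^sub>R v + s *\<^sub>R w + s\<^sup>2 *\<^sub>R B u v w)) \<le> C * (s * norm (v, w)) ^ 3"
      using elim B by (simp add: norm_power)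
    have "(?p s - (s *\<^sub>R v + s *\<^sub>R w)) /\<^sub>R s\<^sup>2 - B u v w
        = (?p s - (s *\<^sub>R v + s *\<^sub>R w + s\<^sup>2 *\<^sub>R B u v w)) /\<^sub>R s\<^sup>2"
      using elim by (simp add: scaleR_right_diff_distrib scaleR_right_distrib)
    then have "norm ((?p s - (s *\<^sub>R v + s *\<^sub>R w)) /\<^sub>R s\<^sup>2 - B u v w)
        = norm (?p s - (s *\<^sub>R v + s *\<^sub>R w + s\<^sup>2 *\<^sub>R B u v w)) / s\<^sup>2"
      by (simp add: divide_inverse mult.commute)
    also have "\<dots> \<le> C * (s * norm (v, w)) ^ 3 / s\<^sup>2"
      by (rule divide_right_mono[OF le]) simp
    also have "\<dots> = C * norm (v, w) ^ 3 * s"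
      using elim by (simp add: power_mult_distrib power2_eq_square power3_eq_cube)
    finally show ?case .
  qed
  moreover have "((\<lambda>s. C * norm (v, w) ^ 3 * s) \<longlongrightarrow> 0) (at_right 0)"
    by (rule tendsto_mult_right_zero[OF tendsto_ident_at])
  ultimately show ?thesis
    by (rule LIM_zero_cancel[OF Lim_null_comparison])
qed

section \<open>Left-invariant vector fields and their brackets\<close>

context adapted_lie_groupoid
begin

text \<open>The map \<open>T\<^sub>w\<close> of the overview. Where the source lies in the chart,
  the second argument is the point (\<open>\<sigma>\<close> z, t w), written with \<open>S\<close>
  because \<open>S\<close> is known to be smooth.\<close>

definition translate where
  "translate \<Theta> w p = \<Theta> (fst p, S (fst p) + (0, snd p *\<^sub>R w))"

context
  fixes u and \<Theta> :: "('a \<times> 'b) \<times> ('a \<times> 'b) \<Rightarrow> 'a \<times> 'b"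
  assumes u: "u \<in> U"
    and \<Theta>: "smooth_at \<Theta> ((u, 0), (u, 0))"
    and \<Theta>_product: "\<forall>\<^sub>F p in nhds ((u, 0), (u, 0)). product_in_chart \<Theta> p"
begin

lemma smooth_at_translate_arg: "smooth_at (\<lambda>p. (fst p, S (fst p) + (0, snd p *\<^sub>R w))) ((u, 0), 0)"
proof (intro smooth_at_Pair smooth_at_add smooth_at_fst smooth_at_const smooth_at_scaleR smooth_at_snd smooth_at_ident)
  show "smooth_at (\<lambda>p. S (fst p)) ((u, 0), 0)"
    by (rule smooth_at_compose[OF findim_ab smooth_at_fst[OF smooth_at_ident]]) (use smooth_at_S[OF u] in simp)
qed

lemma smooth_at_translate: "smooth_at (translate \<Theta> w) ((u, 0), 0)"
proof -
  have "smooth_at (\<lambda>p. \<Theta> (fst p, S (fst p) + (0, snd p *\<^sub>R w))) ((u, 0), 0)"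
    by (rule smooth_at_compose[OF findim_prod[OF findim_ab findim_ab] smooth_at_translate_arg])
      (use \<Theta> source_zero[OF u] in simp)
  then show ?thesis unfolding translate_def[abs_def] .
qed

text \<open>Left translation by y takes values in the r-fibre of y, so the first coordinate stays
  that of \<open>fst p\<close>. Injectivity of \<open>\<psi>\<close> then makes the second
  coordinate the unique value sought by the \<open>THE\<close> in
  \<open>product_map\<close>.\<close>

lemma eventually_translate:
  "\<forall>\<^sub>F p in nhds ((u, 0), 0). translate \<Theta> w p \<in> U \<times> V \<and> fst p \<in> U \<times> V \<and>
     \<psi> (translate \<Theta> w p) = gmul G (\<psi> (fst p)) (\<psi> (\<sigma> (fst p), snd p *\<^sub>R w)) \<and>
     \<phi> (\<sigma> (fst p)) = src G (\<psi> (fst p)) \<and>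
     translate \<Theta> w p = (fst (fst p), product_map G U V \<psi> \<phi> (fst (fst p)) (snd (fst p)) (snd p *\<^sub>R w))"
proof -
  have "\<forall>\<^sub>F p in nhds ((u, 0), 0). product_in_chart \<Theta> (fst p, S (fst p) + (0, snd p *\<^sub>R w))"
    by (rule eventually_compose_filterlim[OF \<Theta>_product])
      (use smooth_at_imp_tendsto[OF smooth_at_translate_arg] source_zero[OF u] in simp)
  moreover have "\<forall>\<^sub>F p in nhds ((u, 0), 0::real). src G (\<psi> (fst p)) \<in> \<psi> ` (U \<times> V)"
    by (rule eventually_compose_filterlim[OF eventually_source_in_chart[OF u]])
      (use smooth_at_imp_tendsto[OF smooth_at_fst[OF smooth_at_ident], of "((u, 0), 0)"] in simp)
  ultimately show ?thesis
  proof eventually_elim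
    case (elim p)
    note src = source_in_chart[OF elim(2)]
    let ?z = "fst p" and ?w = "snd p *\<^sub>R w"
    have T: "translate \<Theta> w p = \<Theta> (?z, (\<sigma> ?z, ?w))"
      unfolding translate_def src(3) by simp
    have chart: "translate \<Theta> w p \<in> U \<times> V" "?z \<in> U \<times> V" "(\<sigma> ?z, ?w) \<in> U \<times> V"
      using elim(1) unfolding T product_in_chart_def src(3) by auto
    have comp: "src G (\<psi> ?z) = rng G (\<psi> (\<sigma> ?z, ?w))"
      using rng_\<psi>[OF chart(3)] src(2) by simp
    have prod: "\<psi> (translate \<Theta> w p) = gmul G (\<psi> ?z) (\<psi> (\<sigma> ?z, ?w))"
      using elim(1) comp unfolding T product_in_chart_def src(3) by auto
    have "\<phi> (fst (translate \<Theta> w p)) = \<phi> (fst ?z)"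
      using rng_gmul[OF groupoid comp] rng_\<psi> chart prod by metis
    then have fst_T: "fst (translate \<Theta> w p) = fst ?z"
      using inj_\<phi> chart by (metis inj_on_def mem_Times_iff)
    have "product_map G U V \<psi> \<phi> (fst ?z) (snd ?z) ?w = snd (translate \<Theta> w p)"
      unfolding product_map_def
    proof (rule the_equality)
      show "snd (translate \<Theta> w p) \<in> V \<and> gmul G (\<psi> (fst ?z, snd ?z)) (\<psi> (\<sigma> ?z, ?w)) = \<psi> (fst ?z, snd (translate \<Theta> w p))"
        using prod fst_T chart by (metis mem_Times_iff prod.collapse)
      fix y assume y: "y \<in> V \<and> gmul G (\<psi> (fst ?z, snd ?z)) (\<psi> (\<sigma> ?z, ?w)) = \<psi> (fst ?z, y)"
      then have "\<psi> (translate \<Theta> w p) = \<psi> (fst ?z, y)" using prod by simp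
      then have "translate \<Theta> w p = (fst ?z, y)"
        using \<psi>inv_\<psi>[OF chart(1)] \<psi>inv_\<psi>[of "(fst ?z, y)"] y chart(2) by (simp add: mem_Times_iff)
      then show "y = snd (translate \<Theta> w p)" by simp
    qed
    then have "translate \<Theta> w p = (fst ?z, product_map G U V \<psi> \<phi> (fst ?z) (snd ?z) ?w)"
      using fst_T by (simp add: prod_eq_iff)
    then show ?case using chart prod src(2) by blast
  qed
qed

text \<open>Left unit law: p(u, 0, t w) = t w.\<close>

lemma eventually_translate_line: "\<forall>\<^sub>F t in nhds 0. translate \<Theta> w ((u, 0), t) = (u, t *\<^sub>R w)"
proof -
  have "\<forall>\<^sub>F t in nhds 0. \<psi> (translate \<Theta> w ((u, 0), t)) = gmul G (\<psi> (u, 0)) (\<psi> (u, t *\<^sub>R w)) \<and>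
      translate \<Theta> w ((u, 0), t) \<in> U \<times> V"
    using eventually_compose_filterlim[OF eventually_translate[of w]
        smooth_at_imp_tendsto[OF smooth_at_Pair[OF smooth_at_const smooth_at_ident]]]
    by eventually_elim (use source_zero(2)[OF u] in auto)
  then show ?thesis
    using eventually_vertical_line[OF u, of w]
  proof eventually_elim
    case (elim t)
    have "rng G (\<psi> (u, t *\<^sub>R w)) = \<psi> (u, 0)"
      using rng_\<psi>[OF elim(2)] \<phi>_eq[OF u] by simp
    then have "\<psi> (translate \<Theta> w ((u, 0), t)) = \<psi> (u, t *\<^sub>R w)"
      using elim(1) gmul_rng[OF groupoid, of "\<psi> (u, t *\<^sub>R w)"] by simp
    then show ?case
      using \<psi>inv_\<psi> elim by metis
  qed
qed

text \<open>Right unit law: p(u, v, 0) = v. With the left unit law it evaluates three of the four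
  corners of the mixed difference.\<close>

lemma eventually_translate_zero: "\<forall>\<^sub>F z in nhds (u, 0). translate \<Theta> w (z, 0) = z"
proof -
  have "\<forall>\<^sub>F z in nhds (u, 0). (\<lambda>p. translate \<Theta> w p \<in> U \<times> V \<and> fst p \<in> U \<times> V \<and>
     \<psi> (translate \<Theta> w p) = gmul G (\<psi> (fst p)) (\<psi> (\<sigma> (fst p), snd p *\<^sub>R w)) \<and>
     \<phi> (\<sigma> (fst p)) = src G (\<psi> (fst p)) \<and>
     translate \<Theta> w p = (fst (fst p), product_map G U V \<psi> \<phi> (fst (fst p)) (snd (fst p)) (snd p *\<^sub>R w))) (z, 0)"
    by (rule eventually_compose_filterlim[OF eventually_translate
        smooth_at_imp_tendsto[OF smooth_at_Pair[OF smooth_at_ident smooth_at_const]]])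
  moreover have "\<forall>\<^sub>F z in nhds (u, 0). src G (\<psi> z) \<in> \<psi> ` (U \<times> V)"
    by (rule eventually_source_in_chart[OF u])
  ultimately show ?thesis
  proof eventually_elim
    case (elim z)
    have "\<psi> (translate \<Theta> w (z, 0)) = gmul G (\<psi> z) (\<psi> (\<sigma> z, 0))"
      using elim(1) unfolding fst_conv snd_conv scaleR_zero_left by blast
    also have "\<psi> (\<sigma> z, 0) = src G (\<psi> z)"
      using source_in_chart[OF elim(2)] \<phi>_eq by simp
    finally have "\<psi> (translate \<Theta> w (z, 0)) = \<psi> z"
      by (simp add: gmul_src[OF groupoid])
    then show ?case
      using elim(1) \<psi>inv_\<psi> by (metis fst_conv)
  qed
qed

text \<open>Translation by a unit is the identity, so only the derivative along the vertical line
  remains. This evaluates the outer field in an iterated derivative.\<close>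

lemma left_invariant_extension_at_unit:
  assumes k: "k \<in> smooth_germs (gatlas G) (\<psi> (u, 0))"
    and D: "((\<lambda>t. k (\<psi> (u, t *\<^sub>R w))) has_real_derivative d) (at 0)"
  shows "left_invariant_extension G (vertical_section w) (\<psi> (u, 0)) k = d"
proof -
  have 1: "((\<lambda>t. k (\<psi> (\<Theta> ((u, 0), (\<sigma> (u, 0), t *\<^sub>R w))))) has_real_derivative
      left_invariant_extension G (vertical_section w) (\<psi> (u, 0)) k) (at 0)"
    by (rule left_invariant_extension_in_chart)
      (use source_zero[OF u] \<Theta> \<Theta>_product k zero_section_in_chart[OF u] in simp_all)
  have 2: "\<forall>\<^sub>F t in nhds 0. k (\<psi> (\<Theta> ((u, 0), (\<sigma> (u, 0), t *\<^sub>R w)))) = k (\<psi> (u, t *\<^sub>R w))"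
    using eventually_translate_line[of w]
    by eventually_elim (use source_zero[OF u] in \<open>simp add: translate_def\<close>)
  show ?thesis
    by (rule DERIV_unique[OF DERIV_transform_eventually[OF 1 2] D])
qed

context
  fixes h assumes h: "h \<in> smooth_germs (gatlas G) (\<psi> (u, 0))"
begin

lemma smooth_at_chart_function: "smooth_at (\<lambda>z. h (\<psi> z)) (u, 0)"
  using h smooth_germs_\<psi>_iff[OF zero_section_in_chart[OF u]] by blast

lemma smooth_at_translated_function: "smooth_at (\<lambda>p. h (\<psi> (translate \<Theta> w p))) ((u, 0), 0)"
  by (rule smooth_at_compose[OF findim_ab smooth_at_translate])
    (use eventually_nhds_x_imp_x[OF eventually_translate_zero] smooth_at_chart_function in simp)

text \<open>The field is needed near the unit, not only at it. The conditions on
  \<open>\<Theta>\<close> at (z, \<open>S z\<close>) are open, hence hold for all z near (u, 0). The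
  result is a partial derivative of one fixed smooth function of (z, t).\<close>

lemma eventually_left_invariant_extension:
  "\<forall>\<^sub>F z in nhds (u, 0). left_invariant_extension G (vertical_section w) (\<psi> z) h =
     frechet_derivative (\<lambda>p. h (\<psi> (translate \<Theta> w p))) (at (z, 0)) (0, 1)"
proof -
  have lim: "((\<lambda>z. (z, S z)) \<longlongrightarrow> ((u, 0), (u, 0))) (nhds (u, 0))"
    using smooth_at_imp_tendsto[OF smooth_at_Pair[OF smooth_at_ident smooth_at_S[OF u]]] source_zero[OF u] by simp
  have "\<forall>\<^sub>F z in nhds (u, 0). smooth_at \<Theta> (z, S z)"
    by (rule eventually_compose_filterlim[OF eventually_smooth_at[OF \<Theta>] lim])
  moreover have "\<forall>\<^sub>F z in nhds (u, 0). \<forall>\<^sub>F p in nhds (z, S z). product_in_chart \<Theta> p"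
    by (rule eventually_compose_filterlim[OF _ lim]) (use \<Theta>_product eventually_eventually in blast)
  moreover have "\<forall>\<^sub>F z in nhds (u, 0). smooth_at (\<lambda>p. h (\<psi> (translate \<Theta> w p))) (z, 0)"
    by (rule eventually_compose_filterlim[OF eventually_smooth_at[OF smooth_at_translated_function]
          smooth_at_imp_tendsto[OF smooth_at_Pair[OF smooth_at_ident smooth_at_const]]])
  ultimately show ?thesis
    using eventually_smooth_at[OF smooth_at_chart_function] eventually_in_chart[OF zero_section_in_chart[OF u]]
      eventually_source_in_chart[OF u]
  proof eventually_elim
    case (elim z)
    have "((\<lambda>t. h (\<psi> (\<Theta> (z, (\<sigma> z, t *\<^sub>R w))))) has_real_derivative
        left_invariant_extension G (vertical_section w) (\<psi> z) h) (at 0)"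
      by (rule left_invariant_extension_in_chart) (use elim smooth_germs_\<psi>_iff in auto)
    moreover have "\<Theta> (z, (\<sigma> z, t *\<^sub>R w)) = translate \<Theta> w (z, t)" for t
      using source_in_chart(3)[OF elim(6)] by (simp add: translate_def)
    moreover have "((\<lambda>t. h (\<psi> (translate \<Theta> w (z, t)))) has_real_derivative
        frechet_derivative (\<lambda>p. h (\<psi> (translate \<Theta> w p))) (at (z, 0)) (0, 1)) (at 0)"
      by (rule smooth_at_chain_DERIV[of "\<lambda>p. h (\<psi> (translate \<Theta> w p))" "\<lambda>t. (z, t)"])
        (use elim(3) in \<open>auto intro!: derivative_eq_intros simp: has_vector_derivative_def\<close>)
    ultimately show ?case
      using DERIV_unique by simp
  qed
qed

text \<open>Without this the outer field, applied to the function \<open>X\<^sub>w h\<close>, would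
  return the default 0 for functions that are not germs.\<close>

lemma left_invariant_extension_germ:
  "(\<lambda>y. left_invariant_extension G (vertical_section w) y h) \<in> smooth_germs (gatlas G) (\<psi> (u, 0))"
proof -
  have "smooth_at (\<lambda>z. frechet_derivative (\<lambda>p. h (\<psi> (translate \<Theta> w p))) (at (z, 0)) (0, 1)) (u, 0)"
    by (rule smooth_at_compose[OF findim_prod[OF findim_ab findim_real]
          smooth_at_Pair[OF smooth_at_ident smooth_at_const]
          smooth_at_frechet_derivative[OF smooth_at_translated_function]])
  then show ?thesis
    unfolding smooth_germs_\<psi>_iff[OF zero_section_in_chart[OF u]]
  proof (rule smooth_at_cong)
    show "\<forall>\<^sub>F z in nhds (u, 0). frechet_derivative (\<lambda>p. h (\<psi> (translate \<Theta> w p))) (at (z, 0)) (0, 1) =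
        left_invariant_extension G (vertical_section w) (\<psi> z) h"
      using eventually_left_invariant_extension[of w] by eventually_elim (rule sym)
  qed
qed

text \<open>For k(s, t) = h(\<open>\<psi>\<close>(\<open>T\<^sub>w\<close>((u, s v), t))), the
  t-derivative at t = 0 is \<open>X\<^sub>w h\<close> at \<open>\<psi>\<close>(u, s v). Its
  s-derivative at 0 is the iterated derivative, and \<open>mixed_difference_limit\<close> applies to
  k.\<close>

lemma iterated_derivative_limit:
  "((\<lambda>s. (h (\<psi> (translate \<Theta> w ((u, s *\<^sub>R v), s))) - h (\<psi> (u, s *\<^sub>R v)) - h (\<psi> (u, s *\<^sub>R w)) + h (\<psi> (u, 0))) / s\<^sup>2)
     \<longlongrightarrow> left_invariant_extension G (vertical_section v) (\<psi> (u, 0))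
           (\<lambda>y. left_invariant_extension G (vertical_section w) y h)) (at_right 0)"
proof -
  define K where "K p = h (\<psi> (translate \<Theta> w p))" for p
  define k where "k p = K ((u, fst p *\<^sub>R v), snd p)" for p
  define kt where "kt p = frechet_derivative k (at p) (0, 1)" for p
  have K: "smooth_at K ((u, 0), 0)"
    unfolding K_def by (rule smooth_at_translated_function)
  have k: "smooth_at k (0, 0)"
    unfolding k_def
    by (rule smooth_at_compose[OF findim_prod[OF findim_ab findim_real]])
      (use K in \<open>auto intro!: smooth_at_Pair smooth_at_const smooth_at_scaleR smooth_at_fst smooth_at_snd smooth_at_ident\<close>)
  have kt: "smooth_at kt (0, 0)"
    unfolding kt_def by (rule smooth_at_frechet_derivative[OF k])
  have lim: "((\<lambda>s. (u, s *\<^sub>R v)) \<longlongrightarrow> (u, 0)) (nhds 0)"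
    using smooth_at_imp_tendsto[OF smooth_at_vertical_line, of u v 0] by simp
  have kt_DERIV: "((\<lambda>s. kt (s, 0)) has_real_derivative frechet_derivative kt (at (0, 0)) (1, 0)) (at 0)"
    by (rule smooth_at_chain_DERIV[of kt "\<lambda>s. (s, 0)"])
      (use kt in \<open>auto intro!: derivative_eq_intros simp: has_vector_derivative_def\<close>)
  have "\<forall>\<^sub>F s in nhds 0. smooth_at k (s, 0)"
    by (rule eventually_compose_filterlim[OF eventually_smooth_at[OF k]
          smooth_at_imp_tendsto[OF smooth_at_Pair[OF smooth_at_ident smooth_at_const]]])
  moreover have "\<forall>\<^sub>F s in nhds 0. smooth_at K ((u, s *\<^sub>R v), 0)"
    by (rule eventually_compose_filterlim[OF eventually_smooth_at[OF K] tendsto_Pair[OF lim tendsto_const]])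
  moreover have "\<forall>\<^sub>F s in nhds 0. left_invariant_extension G (vertical_section w) (\<psi> (u, s *\<^sub>R v)) h =
      frechet_derivative K (at ((u, s *\<^sub>R v), 0)) (0, 1)"
    unfolding K_def by (rule eventually_compose_filterlim[OF eventually_left_invariant_extension lim])
  ultimately have ev: "\<forall>\<^sub>F s in nhds 0. kt (s, 0) = left_invariant_extension G (vertical_section w) (\<psi> (u, s *\<^sub>R v)) h"
  proof eventually_elim
    case (elim s)
    have "((\<lambda>t. k (s, t)) has_real_derivative kt (s, 0)) (at 0)"
      unfolding kt_def by (rule smooth_at_chain_DERIV[of k "\<lambda>t. (s, t)"])
        (use elim(1) in \<open>auto intro!: derivative_eq_intros simp: has_vector_derivative_def\<close>)
    moreover have "((\<lambda>t. k (s, t)) has_real_derivative frechet_derivative K (at ((u, s *\<^sub>R v), 0)) (0, 1)) (at 0)"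
      unfolding k_def fst_conv snd_conv
      by (rule smooth_at_chain_DERIV[of K "\<lambda>t. ((u, s *\<^sub>R v), t)"])
        (use elim(2) in \<open>auto intro!: derivative_eq_intros simp: has_vector_derivative_def\<close>)
    ultimately show ?case
      using elim(3) DERIV_unique by simp
  qed
  have "left_invariant_extension G (vertical_section v) (\<psi> (u, 0))
      (\<lambda>y. left_invariant_extension G (vertical_section w) y h) = frechet_derivative kt (at (0, 0)) (1, 0)"
    by (rule left_invariant_extension_at_unit[OF left_invariant_extension_germ
          DERIV_transform_eventually[OF kt_DERIV ev]])
  then have "((\<lambda>s. (k (s, s) - k (s, 0) - k (0, s) + k (0, 0)) / s\<^sup>2)
      \<longlongrightarrow> left_invariant_extension G (vertical_section v) (\<psi> (u, 0))
           (\<lambda>y. left_invariant_extension G (vertical_section w) y h)) (at_right 0)"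
    using mixed_difference_limit[OF k] unfolding kt_def[abs_def] by simp
  \<comment> \<open>The right unit law evaluates k(s, 0) and k(0, 0), the left one k(0, s).\<close>
  moreover have "\<forall>\<^sub>F s in at_right 0. (k (s, s) - k (s, 0) - k (0, s) + k (0, 0)) / s\<^sup>2 =
      (h (\<psi> (translate \<Theta> w ((u, s *\<^sub>R v), s))) - h (\<psi> (u, s *\<^sub>R v)) - h (\<psi> (u, s *\<^sub>R w)) + h (\<psi> (u, 0))) / s\<^sup>2"
  proof (rule filter_leD[of _ "nhds 0"])
    show "at_right 0 \<le> nhds (0::real)" by (simp add: at_within_def)
    show "\<forall>\<^sub>F s in nhds 0. (k (s, s) - k (s, 0) - k (0, s) + k (0, 0)) / s\<^sup>2 =
      (h (\<psi> (translate \<Theta> w ((u, s *\<^sub>R v), s))) - h (\<psi> (u, s *\<^sub>R v)) - h (\<psi> (u, s *\<^sub>R w)) + h (\<psi> (u, 0))) / s\<^sup>2"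
      using eventually_translate_line[of w] eventually_compose_filterlim[OF eventually_translate_zero[of w] lim]
      by eventually_elim
        (use eventually_nhds_x_imp_x[OF eventually_translate_zero[of w]] in \<open>simp add: k_def K_def\<close>)
  qed
  ultimately show ?thesis
    by (rule Lim_transform_eventually)
qed

end

end

text \<open>Two evaluations of the limit of one quotient are compared. The assumption
  \<open>v \<noteq> 0\<close> makes both (v, w) and (w, v) nonzero, so that the expansion applies in
  either order; in the application \<open>v\<close> is a basis vector.\<close>

lemma algebroid_bracket_vertical:
  assumes exp: "product_expansion G U V \<psi> \<phi> B" and u: "u \<in> U" and nz: "v \<noteq> 0"
    and h: "h \<in> smooth_germs (gatlas G) (\<psi> (u, 0))"
  shows "algebroid_bracket G (vertical_section v) (vertical_section w) (\<psi> (u, 0)) h =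
    frechet_derivative (\<lambda>z. h (\<psi> z)) (at (u, 0)) (0, B u v w - B u w v)"
proof -
  obtain \<Theta> where \<Theta>: "smooth_at \<Theta> ((u, 0), (u, 0))" "\<forall>\<^sub>F p in nhds ((u, 0), (u, 0)). product_in_chart \<Theta> p"
    by (rule local_product[OF u])
  define T where "T v w s = translate \<Theta> w ((u, s *\<^sub>R v), s)" for v w s
  let ?p = "\<lambda>v w s. product_map G U V \<psi> \<phi> u (s *\<^sub>R v) (s *\<^sub>R w)"
  have lim: "((\<lambda>s. ((u, s *\<^sub>R v), s)) \<longlongrightarrow> ((u, 0), 0)) (nhds 0)" for v :: 'b
    using smooth_at_imp_tendsto[OF smooth_at_Pair[OF smooth_at_vertical_line smooth_at_ident], of u v 0] by simp
  have le: "at_right 0 \<le> nhds (0::real)" by (simp add: at_within_def)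
  have T: "\<forall>\<^sub>F s in at_right 0. T v w s = (u, ?p v w s)" for v w
  proof (rule filter_leD[OF le])
    show "\<forall>\<^sub>F s in nhds 0. T v w s = (u, ?p v w s)"
      using eventually_compose_filterlim[OF eventually_translate[OF u \<Theta>, of w] lim[of v]]
      unfolding T_def by eventually_elim simp
  qed
  have T_lim: "(T v w \<longlongrightarrow> (u, 0)) (at_right 0)" for v w
  proof -
    have "translate \<Theta> w ((u, 0), 0) = (u, 0)"
      by (rule eventually_nhds_x_imp_x[OF eventually_translate_zero[OF u \<Theta>]])
    then have "(T v w \<longlongrightarrow> (u, 0)) (nhds 0)"
      unfolding T_def using filterlim_compose[OF smooth_at_imp_tendsto[OF smooth_at_translate[OF u \<Theta>, of w]] lim[of v]] by simp
    then show ?thesis by (rule filterlim_mono[OF _ order_refl le])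
  qed
  let ?H = "\<lambda>z. h (\<psi> z)"
  have "((\<lambda>s. ((u, ?p v w s) - (u, ?p w v s)) /\<^sub>R s\<^sup>2) \<longlongrightarrow> (0, B u v w - B u w v)) (at_right 0)"
  proof -
    have "((\<lambda>s. (?p v w s - (s *\<^sub>R v + s *\<^sub>R w)) /\<^sub>R s\<^sup>2 - (?p w v s - (s *\<^sub>R w + s *\<^sub>R v)) /\<^sub>R s\<^sup>2)
        \<longlongrightarrow> B u v w - B u w v) (at_right 0)"
      by (intro tendsto_diff product_expansion_limit[OF exp u]) (use nz in auto)
    moreover have "(?p v w s - (s *\<^sub>R v + s *\<^sub>R w)) /\<^sub>R s\<^sup>2 - (?p w v s - (s *\<^sub>R w + s *\<^sub>R v)) /\<^sub>R s\<^sup>2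
        = (?p v w s - ?p w v s) /\<^sub>R s\<^sup>2" for s
      by (simp add: scaleR_diff_right[symmetric] add.commute)
    ultimately show ?thesis
      by (auto intro!: tendsto_Pair)
  qed
  moreover have "\<forall>\<^sub>F s in at_right 0. ((u, ?p v w s) - (u, ?p w v s)) /\<^sub>R s\<^sup>2 = (T v w s - T w v s) /\<^sub>R s\<^sup>2"
    using T[of v w] T[of w v] by eventually_elim simp
  ultimately have "((\<lambda>s. (T v w s - T w v s) /\<^sub>R s\<^sup>2) \<longlongrightarrow> (0, B u v w - B u w v)) (at_right 0)"
    by (rule Lim_transform_eventually)
  then have 1: "((\<lambda>s. (?H (T v w s) - ?H (T w v s)) / s\<^sup>2) \<longlongrightarrow>
      frechet_derivative ?H (at (u, 0)) (0, B u v w - B u w v)) (at_right 0)"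
    by (rule difference_quotient_limit[OF findim_ab smooth_at_chart_function[OF u \<Theta> h] T_lim T_lim])
  have 2: "((\<lambda>s. (?H (T v w s) - ?H (T w v s)) / s\<^sup>2) \<longlongrightarrow>
      algebroid_bracket G (vertical_section v) (vertical_section w) (\<psi> (u, 0)) h) (at_right 0)"
  proof -
    have "(?H (T v w s) - ?H (T w v s)) / s\<^sup>2 =
        (?H (T v w s) - ?H (u, s *\<^sub>R v) - ?H (u, s *\<^sub>R w) + ?H (u, 0)) / s\<^sup>2 -
        (?H (T w v s) - ?H (u, s *\<^sub>R w) - ?H (u, s *\<^sub>R v) + ?H (u, 0)) / s\<^sup>2" for s
      by (simp add: diff_divide_distrib[symmetric])
    then show ?thesis
      unfolding algebroid_bracket_def lie_bracket_def T_def using h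
      by (simp add: tendsto_diff[OF iterated_derivative_limit[OF u \<Theta> h] iterated_derivative_limit[OF u \<Theta> h]])
  qed
  show ?thesis
    by (rule tendsto_unique[OF _ 2 1]) simp
qed

end

text \<open>Makes the coordinates q_j germs on the unit space. Its atlas need not cover the whole
  type, so it is no \<open>smooth_manifold\<close>, and the openness of chart images is derived from
  slice charts.\<close>

lemma smooth_map_submanifold_bounded_linear:
  fixes A :: "('p::topological_space, 'a::real_inner \<times> 'b::real_inner) atlas"
  assumes "smooth_manifold A" and N: "embedded_submanifold A N" and L: "bounded_linear L"
    and g: "smooth_map (submanifold_atlas A N) euclid W g"
  shows "smooth_map (submanifold_atlas A N) euclid W (\<lambda>x. L (g x))"
  unfolding smooth_map_def
proof (intro conjI ballI)
  interpret smooth_manifold A by fact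
  let ?A = "submanifold_atlas A N"
  have euclid: "(UNIV, id) \<in> euclid" by (simp add: euclid_def)
  show "open_in ?A W" using g unfolding smooth_map_def by blast
  fix x assume "x \<in> W"
  then obtain D c Q where C: "(D, c) \<in> ?A" "x \<in> D" and Q: "open_in ?A Q" "x \<in> Q" "Q \<subseteq> W \<inter> D"
    and sm: "smooth_on (c ` Q) (\<lambda>y. g (inv_into D c y))"
    using g unfolding smooth_map_def euclid_def by (fastforce simp: comp_def)
  obtain E e where E: "D = E \<inter> N" "c = fst \<circ> e" "(E, e) \<in> maximal_atlas A"
    and slice: "e ` (E \<inter> N) = {z \<in> e ` E. snd z = 0}"
    using C(1) unfolding submanifold_atlas_def by blast
  obtain O' where O': "open O'" "Q = N \<inter> O'"
    using Q(1) N unfolding open_in_def embedded_submanifold_def openin_open by auto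
  \<comment> \<open>The image of \<open>Q\<close> is the slice at height 0 of the open image of
    \<open>E \<inter> O'\<close>, hence open in the first factor.\<close>
  have "c ` Q = (\<lambda>a. (a, 0)) -` (e ` (E \<inter> O'))"
  proof (intro set_eqI iffI)
    fix a assume "a \<in> c ` Q"
    then obtain y where y: "y \<in> Q" "a = fst (e y)" using E(2) by auto
    then have "y \<in> E \<inter> N" "y \<in> E \<inter> O'" using Q(3) E(1) O'(2) by blast+
    moreover from this have "e y = (a, 0)" using slice y(2) by (auto simp: prod_eq_iff)
    ultimately show "a \<in> (\<lambda>a. (a, 0)) -` (e ` (E \<inter> O'))" by force
  next
    fix a assume "a \<in> (\<lambda>a. (a, 0)) -` (e ` (E \<inter> O'))"
    then obtain y where y: "y \<in> E" "y \<in> O'" "e y = (a, 0)" by force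
    then have "e y \<in> e ` (E \<inter> N)" unfolding slice using imageI[OF y(1), of e] y(3) by simp
    then obtain y' where "y' \<in> E" "y' \<in> N" "e y = e y'" by blast
    then have "y \<in> N" using chart_inv[OF E(3)] y(1) by metis
    then show "a \<in> c ` Q" using y O'(2) E(2) by force
  qed
  moreover have "open ((\<lambda>a. (a, 0::'b)) -` (e ` (E \<inter> O')))"
    by (rule open_vimage[OF chart_open_image_subset[OF E(3) O'(1)]]) (intro continuous_intros)
  ultimately have "open (c ` Q)" by simp
  then have "smooth_on (c ` Q) (\<lambda>y. L (g (inv_into D c y)))"
    using sm Ck_on_bounded_linear[OF _ L] unfolding smooth_on_def by blast
  then have "open_in ?A Q \<and> x \<in> Q \<and> Q \<subseteq> W \<inter> D \<and> (\<lambda>x. L (g x)) ` Q \<subseteq> UNIV \<and>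
      smooth_on (c ` Q) (id \<circ> (\<lambda>x. L (g x)) \<circ> inv_into D c)"
    using Q by (simp add: comp_def)
  then show "\<exists>(D, c)\<in>?A. \<exists>(D', c')\<in>euclid. x \<in> D \<and> L (g x) \<in> D' \<and>
      (\<exists>Q. open_in ?A Q \<and> x \<in> Q \<and> Q \<subseteq> W \<inter> D \<and> (\<lambda>x. L (g x)) ` Q \<subseteq> D' \<and>
        smooth_on (c ` Q) (c' \<circ> (\<lambda>x. L (g x)) \<circ> inv_into D c))"
    using C euclid by blast
qed

section \<open>The anchor and the structure functions\<close>

context adapted_lie_groupoid
begin

lemma frame_eq_vertical_section: "frame G U \<psi> \<phi> f i = vertical_section (f i)"
  unfolding frame_def vertical_section_def by (rule refl)

context
  fixes u assumes u: "u \<in> U"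
begin

lemma vertical_section_at: "vertical_section w (\<psi> (u, 0)) = velocity (gatlas G) (\<lambda>t. \<psi> (u, t *\<^sub>R w))"
  unfolding vertical_section_def using \<phi>_eq[OF u] inv_into_f_f[OF inj_\<phi> u] by simp

lemma vertical_section_eq_frechet_derivative:
  assumes h: "h \<in> smooth_germs (gatlas G) (\<psi> (u, 0))"
  shows "vertical_section w (\<psi> (u, 0)) h = frechet_derivative (\<lambda>z. h (\<psi> z)) (at (u, 0)) (0, w)"
  unfolding vertical_section_at
proof (rule velocity_eqI)
  have "smooth_at (\<lambda>z. h (\<psi> z)) (u, 0)"
    using h smooth_germs_\<psi>_iff[OF zero_section_in_chart[OF u]] by blast
  moreover have "((\<lambda>t. (u, t *\<^sub>R w)) has_vector_derivative (0, w)) (at 0)"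
    by (auto intro!: derivative_eq_intros simp: has_vector_derivative_def)
  ultimately show "((\<lambda>t. h (\<psi> (u, t *\<^sub>R w))) has_real_derivative
      frechet_derivative (\<lambda>z. h (\<psi> z)) (at (u, 0)) (0, w)) (at 0)"
    using smooth_at_chain_DERIV[of "\<lambda>z. h (\<psi> z)" "\<lambda>t. (u, t *\<^sub>R w)" 0 "(0, w)"] by simp
qed (use h in simp)

text \<open>The curve t |-> \<open>\<psi>\<close>(u, t w) stays in one r-fibre for small t, so any
  function composed with r is constant along it.\<close>

lemma vertical_section_in_fibre: "vertical_section w (\<psi> (u, 0)) \<in> algebroid_fibre G (\<psi> (u, 0))"
proof -
  let ?\<gamma> = "\<lambda>t. \<psi> (u, t *\<^sub>R w)"
  have "velocity (gatlas G) ?\<gamma> \<in> tangent_space (gatlas G) (\<psi> (u, 0))"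
    using velocity_in_tangent_space[OF smooth_param_vertical_line[OF u, of w]] by simp
  moreover have "velocity (gatlas G) ?\<gamma> (h \<circ> rng G) = 0" for h
  proof (cases "h \<circ> rng G \<in> smooth_germs (gatlas G) (?\<gamma> 0)")
    case True
    have ev: "\<forall>\<^sub>F t in nhds 0. h (\<phi> u) = (h \<circ> rng G) (?\<gamma> t)"
      using eventually_vertical_line[OF u, of w] by eventually_elim (simp add: rng_\<psi>)
    show ?thesis
      by (rule velocity_eqI[where \<gamma> = ?\<gamma>, OF True DERIV_transform_eventually[OF DERIV_const ev]])
  qed (simp add: velocity_def)
  ultimately show ?thesis
    unfolding algebroid_fibre_def vertical_section_at by (auto simp: tangent_map_def)
qed

text \<open>By the definition of \<open>\<sigma>\<close>, the function q_j composed with s and the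
  vertical line is the j-th component of \<open>\<sigma>\<close>. The work is to show that q_j and
  its composite with s are germs, since otherwise the default 0 would appear.\<close>

lemma anchor_vertical_section_coord:
  "anchor_section G (vertical_section w) (\<psi> (u, 0)) (coord U \<phi> \<epsilon> j) =
     deriv (\<lambda>t. sigma_map G U \<psi> \<phi> u (t *\<^sub>R w) \<bullet> \<epsilon> j) 0"
proof -
  let ?q = "coord U \<phi> \<epsilon> j" and ?x = "\<psi> (u, 0)"
  have inv: "smooth_map (submanifold_atlas (gatlas G) (units G)) euclid (\<phi> ` U) (inv_into U \<phi>)"
    using charts unfolding adapted_charts_def diffeo_onto_open_def unit_atlas_def by blast
  have units: "embedded_submanifold (gatlas G) (units G)"
    using lie unfolding lie_groupoid_def by blast
  have "smooth_map (unit_atlas G) euclid (\<phi> ` U) ?q"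
    unfolding unit_atlas_def coord_def[abs_def]
    by (rule smooth_map_submanifold_bounded_linear[OF smooth_manifold_axioms units bounded_linear_inner_left inv])
  then have q: "?q \<in> smooth_germs (unit_atlas G) (src G ?x)"
    unfolding smooth_germs_def using source_zero(1)[OF u] \<phi>_eq[OF u] u by auto
  have "smooth_at (\<lambda>z. fst (S z) \<bullet> \<epsilon> j) (u, 0)"
    by (rule smooth_at_bounded_linear[OF bounded_linear_inner_left smooth_at_fst[OF smooth_at_S[OF u]]])
  then have "smooth_at (\<lambda>z. (?q \<circ> src G) (\<psi> z)) (u, 0)"
  proof (rule smooth_at_cong)
    show "\<forall>\<^sub>F z in nhds (u, 0). fst (S z) \<bullet> \<epsilon> j = (?q \<circ> src G) (\<psi> z)"
      using eventually_source_in_chart[OF u]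
      by eventually_elim (use source_in_chart(3) in \<open>simp add: coord_def sigma_map_def\<close>)
  qed
  then have "?q \<circ> src G \<in> smooth_germs (gatlas G) ?x"
    using smooth_germs_\<psi>_iff[OF zero_section_in_chart[OF u]] by blast
  then have "velocity (gatlas G) (\<lambda>t. \<psi> (u, t *\<^sub>R w)) (?q \<circ> src G) =
      deriv (\<lambda>t. sigma_map G U \<psi> \<phi> u (t *\<^sub>R w) \<bullet> \<epsilon> j) 0"
    by (simp add: velocity_def comp_def coord_def sigma_map_def)
  then show ?thesis
    unfolding anchor_section_def anchor_def
    using vertical_section_in_fibre q by (simp add: tangent_map_def vertical_section_at)
qed

text \<open>These germs are dual to the vertical sections: for \<open>b = f k\<close> they read off
  the k-th coefficient of a combination of the frame.\<close>

lemma vertical_coordinate: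
  "(\<lambda>y. snd (\<psi>inv y) \<bullet> b) \<in> smooth_germs (gatlas G) (\<psi> (u, 0))"
  "vertical_section w (\<psi> (u, 0)) (\<lambda>y. snd (\<psi>inv y) \<bullet> b) = w \<bullet> b"
proof -
  let ?h = "\<lambda>y. snd (\<psi>inv y) \<bullet> b"
  have "smooth_at (\<lambda>z. snd z \<bullet> b) (u, 0)"
    by (rule smooth_at_bounded_linear[OF bounded_linear_inner_left smooth_at_snd[OF smooth_at_ident]])
  then have "smooth_at (\<lambda>z. ?h (\<psi> z)) (u, 0)"
  proof (rule smooth_at_cong)
    show "\<forall>\<^sub>F z in nhds (u, 0). snd z \<bullet> b = ?h (\<psi> z)"
      using eventually_in_chart[OF zero_section_in_chart[OF u]] by eventually_elim (simp add: \<psi>inv_\<psi>)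
  qed
  then show germ: "?h \<in> smooth_germs (gatlas G) (\<psi> (u, 0))"
    using smooth_germs_\<psi>_iff[OF zero_section_in_chart[OF u]] by blast
  have D: "((\<lambda>t. t * (w \<bullet> b)) has_real_derivative w \<bullet> b) (at 0)"
    by (auto intro!: derivative_eq_intros)
  have ev: "\<forall>\<^sub>F t in nhds 0. t * (w \<bullet> b) = ?h (\<psi> (u, t *\<^sub>R w))"
    using eventually_vertical_line[OF u, of w] by eventually_elim (simp add: \<psi>inv_\<psi>)
  show "vertical_section w (\<psi> (u, 0)) ?h = w \<bullet> b"
    unfolding vertical_section_at
    by (rule velocity_eqI[OF _ DERIV_transform_eventually[OF D ev]]) (use germ in simp)
qed

text \<open>The \<open>THE\<close> in \<open>structure_c\<close> needs existence and uniqueness.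
  Existence comes from expanding \<open>?d\<close> in the basis and linearity of the derivative of
  \<open>h \<circ> \<psi>\<close>, uniqueness from evaluation on the germs of
  \<open>vertical_coordinate\<close>.\<close>

lemma structure_c_eq:
  assumes f: "canonical_basis m f" and exp: "product_expansion G U V \<psi> \<phi> B"
    and ijk: "i \<in> {1..m}" "j \<in> {1..m}" "k \<in> {1..m}"
  shows "structure_c G U \<psi> \<phi> m f i j k (\<psi> (u, 0)) = B u (f i) (f j) \<bullet> f k - B u (f j) (f i) \<bullet> f k"
proof -
  let ?x = "\<psi> (u, 0)" and ?d = "B u (f i) (f j) - B u (f j) (f i)"
  have orth: "f l \<bullet> f l' = (if l = l' then 1 else 0)" if "l \<in> {1..m}" "l' \<in> {1..m}" for l l'
    using f that unfolding canonical_basis_def by blast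
  have "f i \<noteq> 0" using orth[OF ijk(1,1)] by auto
  define c where "c l = (if l \<in> {1..m} then ?d \<bullet> f l else 0)" for l
  have "algebroid_bracket G (frame G U \<psi> \<phi> f i) (frame G U \<psi> \<phi> f j) ?x h =
      (\<Sum>l=1..m. c l * frame G U \<psi> \<phi> f l ?x h)" for h
  proof (cases "h \<in> smooth_germs (gatlas G) ?x")
    case True
    let ?H = "\<lambda>z. h (\<psi> z)"
    have "smooth_at ?H (u, 0)"
      using True smooth_germs_\<psi>_iff[OF zero_section_in_chart[OF u]] by blast
    then have lin: "linear (frechet_derivative ?H (at (u, 0)))"
      using smooth_at_imp_has_derivative has_derivative_linear by blast
    have d: "(0, ?d) = (\<Sum>l=1..m. c l *\<^sub>R (0, f l))"
    proof -
      have "?d = (\<Sum>l=1..m. c l *\<^sub>R f l)"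
        by (subst canonical_basis_expansion[OF f]) (simp add: c_def)
      then show ?thesis by (simp add: sum_prod)
    qed
    have "frechet_derivative ?H (at (u, 0)) (0, ?d) =
        (\<Sum>l=1..m. c l * frechet_derivative ?H (at (u, 0)) (0, f l))"
      unfolding d by (simp only: linear_sum[OF lin] linear_scale[OF lin] real_scaleR_def)
    then show ?thesis
      unfolding frame_eq_vertical_section algebroid_bracket_vertical[OF exp u \<open>f i \<noteq> 0\<close> True]
        vertical_section_eq_frechet_derivative[OF True] .
  next
    \<comment> \<open>Equality of tangent vectors concerns all functions; off the germs both sides
      are the default 0.\<close>
    case False
    then show ?thesis
      by (simp add: algebroid_bracket_def lie_bracket_def frame_eq_vertical_section vertical_section_at velocity_def)
  qed
  then have c: "(\<forall>l. l \<notin> {1..m} \<longrightarrow> c l = 0) \<and>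
      algebroid_bracket G (frame G U \<psi> \<phi> f i) (frame G U \<psi> \<phi> f j) ?x =
        (\<lambda>h. \<Sum>l=1..m. c l * frame G U \<psi> \<phi> f l ?x h)"
    by (auto simp: c_def)
  have unique: "c' = c"
    if c': "(\<forall>l. l \<notin> {1..m} \<longrightarrow> c' l = 0) \<and>
      algebroid_bracket G (frame G U \<psi> \<phi> f i) (frame G U \<psi> \<phi> f j) ?x =
        (\<lambda>h. \<Sum>l=1..m. c' l * frame G U \<psi> \<phi> f l ?x h)" for c'
  proof
    fix k
    show "c' k = c k"
    proof (cases "k \<in> {1..m}")
      case True
      have coeff: "(\<Sum>l=1..m. a l * frame G U \<psi> \<phi> f l ?x (\<lambda>y. snd (\<psi>inv y) \<bullet> f k)) = a k" for a :: "nat \<Rightarrow> real"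
      proof -
        have "(\<Sum>l=1..m. a l * frame G U \<psi> \<phi> f l ?x (\<lambda>y. snd (\<psi>inv y) \<bullet> f k)) =
            (\<Sum>l=1..m. if l = k then a l else 0)"
          using True orth by (intro sum.cong) (simp_all add: frame_eq_vertical_section vertical_coordinate(2))
        then show ?thesis using True by simp
      qed
      have "(\<lambda>h. \<Sum>l=1..m. c' l * frame G U \<psi> \<phi> f l ?x h) = (\<lambda>h. \<Sum>l=1..m. c l * frame G U \<psi> \<phi> f l ?x h)"
        using c c' by simp
      from fun_cong[OF this] show ?thesis
        using coeff[of c'] coeff[of c] by (rule box_equals)
    qed (use c c' in simp)
  qed
  have "(THE c. (\<forall>l. l \<notin> {1..m} \<longrightarrow> c l = 0) \<and>
      algebroid_bracket G (frame G U \<psi> \<phi> f i) (frame G U \<psi> \<phi> f j) ?x =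
        (\<lambda>h. \<Sum>l=1..m. c l * frame G U \<psi> \<phi> f l ?x h)) = c"
    using c unique by (rule the_equality)
  then show ?thesis
    unfolding structure_c_def using ijk(3) by (simp add: c_def inner_diff_left)
qed

end

end

theorem proposition3p1:
  fixes G :: "('g::{t2_space, second_countable_topology},
               'a::real_inner \<times> 'b::real_inner) groupoid_manifold"
    and n m :: nat
    and \<epsilon> :: "nat \<Rightarrow> 'a" and f :: "nat \<Rightarrow> 'b"
    and x0 :: 'g
    and U :: "'a set" and V :: "'b set"
    and \<psi> :: "'a \<times> 'b \<Rightarrow> 'g" and \<phi> :: "'a \<Rightarrow> 'g"
    and B :: "'a \<Rightarrow> 'b \<Rightarrow> 'b \<Rightarrow> 'b"
  assumes "canonical_basis n \<epsilon>" and "canonical_basis m f"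
    and "lie_groupoid G"
    and "x0 \<in> units G"
    and "adapted_charts G U V \<psi> \<phi> x0"
    and "product_expansion G U V \<psi> \<phi> B"
  shows "\<forall>u\<in>U.
     (\<forall>i\<in>{1..m}. \<forall>j\<in>{1..n}.
        structure_a G U \<psi> \<phi> \<epsilon> f i j (\<phi> u) =
          deriv (\<lambda>t. sigma_map G U \<psi> \<phi> u (t *\<^sub>R f i) \<bullet> \<epsilon> j) 0) \<and>
     (\<forall>i\<in>{1..m}. \<forall>j\<in>{1..m}. \<forall>k\<in>{1..m}.
        structure_c G U \<psi> \<phi> m f i j k (\<phi> u) =
          B u (f i) (f j) \<bullet> f k - B u (f j) (f i) \<bullet> f k)"
proof -
  interpret adapted_lie_groupoid G U V \<psi> \<phi> x0
    by unfold_locales (use assms canonical_basis_imp_findim[OF assms(1)] canonical_basis_imp_findim[OF assms(2)] in auto)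
  show ?thesis
    using anchor_vertical_section_coord structure_c_eq[OF _ assms(2,6)] \<phi>_eq
    by (simp add: structure_a_def frame_eq_vertical_section)
qed

end
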